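(* Let $\mathcal{C}$ be a set of frame conditions and $\mathcal{G}$ a nested sequent. If $\mathcal{G}$ is valid with respect to the class of frames $\mathscr{F}(\mathcal{C})$, then $\mathcal{G}$ is provable in $\mathsf{N}\mathsf{Q}^{\circ}_{=}.\mathsf{K}(\mathcal{C})$.
   Context: Syntax. Terms are variables or constants. Formulas (negation normal form): $\phi ::= P(\vec t)\mid \neg P(\vec t)\mid t=s\mid t\neq s\mid \phi\lor\phi\mid\phi\land\phi\mid\exists x\phi\mid\forall x\phi\mid\Diamond\phi\mid\Box\phi$ ($P$ an $n$-ary predicate, $n\ge 0$). A literal is $P(\vec t)$, $\neg P(\vec t)$, $t=s$ or $t\neq s$; a negative literal is $\neg P(\vec t)$ or $t\neq s$. The negation $\overline{\phi}$ swaps $P(\vec t)/\neg P(\vec t)$, $=/\neq$, $\lor/\land$, $\exists/\forall$, $\Diamond/\Box$ (De Morgan duals). $\phi(t/x)$ is capture-avoiding substitution for free occurrences; formulas differing only in bound variable names are identified. Frames and models. A frame is $\langle W,R,U,D\rangle$ with $W\neq\emptyset$, $R\subseteq W\times W$, $U\neq\emptyset$ (outer domain) and $D_w\subseteq U$ for each $w\in W$ (inner domains). A model adds $I$ with $I_w(P)\subseteq U^n$ for $n$-ary $P$ ($U^0=\{\langle\rangle\}$) and $I_w(a)\in U$ for constants $a$, where $wRu$ implies $I_w(a)=I_u(a)$. An assignment is $\sigma:\mathrm{Var}\to U$; $I^\sigma_w(x)=\sigma(x)$, $I^\sigma_w(a)=I_w(a)$. Satisfaction $M,w,\sigma\Vdash\cdot$: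 $P(\vec t)$ iff $I^\sigma_w(\vec t)\in I_w(P)$; $\neg P(\vec t)$ iff not; $t=s$ iff $I^\sigma_w(t)=I^\sigma_w(s)$; $t\neq s$ iff not; $\lor,\land$ classical; $\exists x\phi$ (resp. $\forall x\phi$) iff for some (resp. all) $o\in D_w$, $M,w,\sigma[x\mapsto o]\Vdash\phi$; $\Diamond\phi$ (resp. $\Box\phi$) iff for some (resp. all) $u$ with $wRu$, $M,u,\sigma\Vdash\phi$. Frame conditions: $\mathbf D$: every $w$ has some $u$ with $wRu$; $\mathbf G(n,k)$ ($n,k\in\mathbb N$): $wR^nu$ and $wR^kv$ imply $uRv$ ($R^0$ = identity); $\mathbf{ID}$: $wRv\Rightarrow D_w\subseteq D_v$; $\mathbf{DD}$: $wRv\Rightarrow D_v\subseteq D_w$; $\mathbf{CD}$: $D_w=U$ for all $w$; $\mathbf{NE}$: $D_w\neq\emptyset$ for all $w$. $\mathcal C$ is a set of such conditions, assumed closed: if one of these conditions holds on every frame satisfying all of $\mathcal C$, it belongs to $\mathcal C$. $\mathscr F(\mathcal C)$ is the class of frames satisfying all conditions in $\mathcal C$; $\mathbf G$ denotes the set of all $\mathbf G(n,k)\in\mathcal C$. Grammars. Characters $\mathsf f$ (forward), $\mathsf b$ (backward). A $\Sigma$-system $S$ is a set of productions $c\to s$, $c\in\{\mathsf f,\mathsf b\}$, $s$ a string over $\{\mathsf f,\mathsf b\}$; $s'cr'\to s'sr'$ is a one-step derivation, $\to^*_S$ its reflexive-transitive closure, $L_S(s)=\{t: s\to^*_S t\}$.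 $S(\mathbf G)$ contains $\mathsf f\to\mathsf b^n\mathsf f^k$ and $\mathsf b\to\mathsf b^k\mathsf f^n$ for each $\mathbf G(n,k)\in\mathbf G$; $S4=\{\mathsf f\to\varepsilon,\mathsf b\to\varepsilon,\mathsf f\to\mathsf f\mathsf f,\mathsf b\to\mathsf b\mathsf b\}$; $S5=\{\mathsf f\to\varepsilon,\mathsf b\to\varepsilon,\mathsf f\to\mathsf b\mathsf f,\mathsf b\to\mathsf b\mathsf f\}$. Nested sequents. A flat sequent is $\vec t,\vec\phi$: a finite multiset $\vec t$ of terms (signature) and a finite multiset $\vec\phi$ of formulas. A nested sequent is $\Gamma,[\mathcal H_1],\dots,[\mathcal H_n]$ ($n\ge 0$) with $\Gamma$ flat and $\mathcal H_i$ nested sequents; it is a tree of flat sequents (components), each with a unique name, $\Gamma$ being the root and the roots of the $\mathcal H_i$ its children. A context $\mathcal G\{\}$ has a hole in a component; $\mathcal G\{\mathcal H\}$ fills it, $\mathcal G\{\emptyset\}$ removes it; $\mathcal G\{\cdot\}_{w}\{\cdot\}_{u}$ indicates holes in the components named $w,u$. Propagation: for each parent $w$ and child $u$ we have $w\xrightarrow{\mathsf f}u$ and $u\xrightarrow{\mathsf b}w$; $w\xrightarrow{c_1\cdots c_m}u$ means there are components $w=v_0,\dots,v_m=u$ with $v_{i-1}\xrightarrow{c_i}v_i$ ($w=u$ for the empty string); $w\xrightarrow{L}u$ means $w\xrightarrow{s}u$ for some $s\in L$. Sequent semantics. An interpretation $\iota$ maps names to worlds. $M,\sigma,\iota\Vdash\mathcal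 G$ iff: if (1) $\iota(u)R\iota(v)$ for each parent $u$ and child $v$, and (2) $I^\sigma_{\iota(u)}(t)\in D_{\iota(u)}$ for each term $t$ in the signature of each component $u$, then (3) for some component $v$ with formulas $\vec\phi$, $M,\iota(v),\sigma\Vdash\bigvee\vec\phi$. $\mathcal G$ is valid w.r.t. $\mathscr F(\mathcal C)$ iff $M,\sigma,\iota\Vdash\mathcal G$ for all models $M$ on frames in $\mathscr F(\mathcal C)$, assignments $\sigma$, interpretations $\iota$. Calculus. Rules (premises $\Rightarrow$ conclusion): (ax) $\Rightarrow\mathcal G\{L,\overline L\}$, $L$ a literal; ($\lor$) $\mathcal G\{\phi,\psi\}\Rightarrow\mathcal G\{\phi\lor\psi\}$; ($\land$) $\mathcal G\{\phi\}$, $\mathcal G\{\psi\}\Rightarrow\mathcal G\{\phi\land\psi\}$; ($\exists$) $\mathcal G\{t,\exists x\psi,\psi(t/x)\}\Rightarrow\mathcal G\{t,\exists x\psi\}$; ($\forall$) $\mathcal G\{y,\phi(y/x)\}\Rightarrow\mathcal G\{\forall x\phi\}$, $y$ a variable not free in the conclusion; ($\Diamond$) $\mathcal G\{\Diamond\phi\}_w\{\phi\}_u\Rightarrow\mathcal G\{\Diamond\phi\}_w\{\emptyset\}_u$ provided $w\xrightarrow{L}u$, $L=L_{S(\mathbf G)}(\mathsf f)$; ($\Box$) $\mathcal G\{[\phi]\}\Rightarrow\mathcal G\{\Box\phi\}$; (ref) $\mathcal G\{t\neq t\}\Rightarrow\mathcal G\{\emptyset\}$; (rep) $\mathcal G\{t\neq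 s,N(t/z),N(s/z)\}\Rightarrow\mathcal G\{t\neq s,N(t/z)\}$, $N$ a negative literal; (drep) $\mathcal G\{s,t,t\neq s\}\Rightarrow\mathcal G\{t,t\neq s\}$; (rig) $\mathcal G\{s\neq t\}_w\{s\neq t\}_u\Rightarrow\mathcal G\{s\neq t\}_w\{\emptyset\}_u$, $w\neq u$; (dp) $\mathcal G\{t\}_w\{t\}_u\Rightarrow\mathcal G\{t\}_w\{\emptyset\}_u$, $w\neq u$, $w\xrightarrow{L}u$ with $L=L_{S4\cup S(\mathbf G)}(\mathsf f)$ if $\mathbf{ID}\in\mathcal C,\mathbf{DD}\notin\mathcal C$, $L=L_{S4\cup S(\mathbf G)}(\mathsf b)$ if $\mathbf{DD}\in\mathcal C,\mathbf{ID}\notin\mathcal C$, $L=L_{S5}(\mathsf f)$ if both; (d) $\mathcal G\{[\emptyset]\}\Rightarrow\mathcal G\{\emptyset\}$; (nd) $\mathcal G\{y\}\Rightarrow\mathcal G\{\emptyset\}$, $y$ a variable not free in the conclusion; (cd) $\mathcal G\{t\}\Rightarrow\mathcal G\{\emptyset\}$. $\mathsf N\mathsf Q^\circ_=.\mathsf K(\mathcal C)$ consists of ax, $\lor$, $\land$, $\exists$, $\forall$, $\Diamond$, $\Box$, ref, rep, drep, rig, plus dp iff $\mathcal C\cap\{\mathbf{ID},\mathbf{DD}\}\neq\emptyset$, nd iff $\mathbf{NE}\in\mathcal C$, cd iff $\mathbf{CD}\in\mathcal C$, d iff $\mathbf D\in\mathcal C$. A proof is a finite tree of nested sequents whose nodes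 are conclusions of rule instances with their children as premises and whose leaves are ax instances. *)

theory Defs
  imports "HOL-Library.Multiset"
begin

subsection \<open>Syntax\<close>

text \<open>Formulas are represented up to renaming of bound variables by de Bruijn indices:
  \<open>Ex \<phi>\<close> and \<open>All \<phi>\<close> bind index \<open>0\<close> of \<open>\<phi>\<close>, and index \<open>Suc n\<close> inside the body is
  the variable \<open>n\<close> outside of it. The variables are thus the natural numbers.\<close>

datatype 'c tm = Var nat | Cst 'c

datatype ('p, 'c) fm =
    Pos 'p "'c tm list"
  | Neg 'p "'c tm list"
  | Eq "'c tm" "'c tm"
  | Neq "'c tm" "'c tm"
  | Or "('p, 'c) fm" "('p, 'c) fm"
  | And "('p, 'c) fm" "('p, 'c) fm"
  | Ex "('p, 'c) fm"
  | All "('p, 'c) fm"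
  | Dia "('p, 'c) fm"
  | Box "('p, 'c) fm"

primrec wf_fm :: "('p \<Rightarrow> nat) \<Rightarrow> ('p, 'c) fm \<Rightarrow> bool" where
  "wf_fm ar (Pos P ts) \<longleftrightarrow> length ts = ar P"
| "wf_fm ar (Neg P ts) \<longleftrightarrow> length ts = ar P"
| "wf_fm ar (Eq t s) \<longleftrightarrow> True"
| "wf_fm ar (Neq t s) \<longleftrightarrow> True"
| "wf_fm ar (Or \<phi> \<psi>) \<longleftrightarrow> wf_fm ar \<phi> \<and> wf_fm ar \<psi>"
| "wf_fm ar (And \<phi> \<psi>) \<longleftrightarrow> wf_fm ar \<phi> \<and> wf_fm ar \<psi>"
| "wf_fm ar (Ex \<phi>) \<longleftrightarrow> wf_fm ar \<phi>"
| "wf_fm ar (All \<phi>) \<longleftrightarrow> wf_fm ar \<phi>"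
| "wf_fm ar (Dia \<phi>) \<longleftrightarrow> wf_fm ar \<phi>"
| "wf_fm ar (Box \<phi>) \<longleftrightarrow> wf_fm ar \<phi>"

primrec is_literal :: "('p, 'c) fm \<Rightarrow> bool" where
  "is_literal (Pos P ts) \<longleftrightarrow> True"
| "is_literal (Neg P ts) \<longleftrightarrow> True"
| "is_literal (Eq t s) \<longleftrightarrow> True"
| "is_literal (Neq t s) \<longleftrightarrow> True"
| "is_literal (Or \<phi> \<psi>) \<longleftrightarrow> False"
| "is_literal (And \<phi> \<psi>) \<longleftrightarrow> False"
| "is_literal (Ex \<phi>) \<longleftrightarrow> False"
| "is_literal (All \<phi>) \<longleftrightarrow> False"
| "is_literal (Dia \<phi>) \<longleftrightarrow> False"
| "is_literal (Box \<phi>) \<longleftrightarrow> False"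

definition is_negative_literal :: "('p, 'c) fm \<Rightarrow> bool" where
  "is_negative_literal \<phi> \<longleftrightarrow> (\<exists>P ts. \<phi> = Neg P ts) \<or> (\<exists>t s. \<phi> = Neq t s)"

primrec neg :: "('p, 'c) fm \<Rightarrow> ('p, 'c) fm" where
  "neg (Pos P ts) = Neg P ts"
| "neg (Neg P ts) = Pos P ts"
| "neg (Eq t s) = Neq t s"
| "neg (Neq t s) = Eq t s"
| "neg (Or \<phi> \<psi>) = And (neg \<phi>) (neg \<psi>)"
| "neg (And \<phi> \<psi>) = Or (neg \<phi>) (neg \<psi>)"
| "neg (Ex \<phi>) = All (neg \<phi>)"
| "neg (All \<phi>) = Ex (neg \<phi>)"
| "neg (Dia \<phi>) = Box (neg \<phi>)"
| "neg (Box \<phi>) = Dia (neg \<phi>)"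

primrec fv_tm :: "'c tm \<Rightarrow> nat set" where
  "fv_tm (Var x) = {x}"
| "fv_tm (Cst a) = {}"

primrec fv :: "('p, 'c) fm \<Rightarrow> nat set" where
  "fv (Pos P ts) = (\<Union>t \<in> set ts. fv_tm t)"
| "fv (Neg P ts) = (\<Union>t \<in> set ts. fv_tm t)"
| "fv (Eq t s) = fv_tm t \<union> fv_tm s"
| "fv (Neq t s) = fv_tm t \<union> fv_tm s"
| "fv (Or \<phi> \<psi>) = fv \<phi> \<union> fv \<psi>"
| "fv (And \<phi> \<psi>) = fv \<phi> \<union> fv \<psi>"
| "fv (Ex \<phi>) = {n. Suc n \<in> fv \<phi>}"
| "fv (All \<phi>) = {n. Suc n \<in> fv \<phi>}"
| "fv (Dia \<phi>) = fv \<phi>"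
| "fv (Box \<phi>) = fv \<phi>"

primrec shift_tm :: "'c tm \<Rightarrow> 'c tm" where
  "shift_tm (Var x) = Var (Suc x)"
| "shift_tm (Cst a) = Cst a"

primrec subst_tm :: "(nat \<Rightarrow> 'c tm) \<Rightarrow> 'c tm \<Rightarrow> 'c tm" where
  "subst_tm \<theta> (Var x) = \<theta> x"
| "subst_tm \<theta> (Cst a) = Cst a"

definition under_binder :: "(nat \<Rightarrow> 'c tm) \<Rightarrow> nat \<Rightarrow> 'c tm" where
  "under_binder \<theta> = case_nat (Var 0) (\<lambda>n. shift_tm (\<theta> n))"

primrec subst :: "(nat \<Rightarrow> 'c tm) \<Rightarrow> ('p, 'c) fm \<Rightarrow> ('p, 'c) fm" where
  "subst \<theta> (Pos P ts) = Pos P (map (subst_tm \<theta>) ts)"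
| "subst \<theta> (Neg P ts) = Neg P (map (subst_tm \<theta>) ts)"
| "subst \<theta> (Eq t s) = Eq (subst_tm \<theta> t) (subst_tm \<theta> s)"
| "subst \<theta> (Neq t s) = Neq (subst_tm \<theta> t) (subst_tm \<theta> s)"
| "subst \<theta> (Or \<phi> \<psi>) = Or (subst \<theta> \<phi>) (subst \<theta> \<psi>)"
| "subst \<theta> (And \<phi> \<psi>) = And (subst \<theta> \<phi>) (subst \<theta> \<psi>)"
| "subst \<theta> (Ex \<phi>) = Ex (subst (under_binder \<theta>) \<phi>)"
| "subst \<theta> (All \<phi>) = All (subst (under_binder \<theta>) \<phi>)"
| "subst \<theta> (Dia \<phi>) = Dia (subst \<theta> \<phi>)"
| "subst \<theta> (Box \<phi>) = Box (subst \<theta> \<phi>)"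

text \<open>\<open>subst_var t z \<phi>\<close> is \<open>\<phi>(t/z)\<close>. For the body \<open>\<phi>\<close> of a quantifier, \<open>inst t \<phi>\<close> is
  \<open>\<phi>(t/x)\<close> where \<open>x\<close> is the variable bound by that quantifier.\<close>

definition subst_var :: "'c tm \<Rightarrow> nat \<Rightarrow> ('p, 'c) fm \<Rightarrow> ('p, 'c) fm" where
  "subst_var t z \<phi> = subst (Var(z := t)) \<phi>"

definition inst :: "'c tm \<Rightarrow> ('p, 'c) fm \<Rightarrow> ('p, 'c) fm" where
  "inst t \<phi> = subst (case_nat t Var) \<phi>"


subsection \<open>Frames and models\<close>

record ('w, 'u) frame =
  worlds :: "'w set"
  acc :: "('w \<times> 'w) set"
  outer :: "'u set"
  inner :: "'w \<Rightarrow> 'u set"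

record ('w, 'u, 'p, 'c) model = "('w, 'u) frame" +
  pred_int :: "'w \<Rightarrow> 'p \<Rightarrow> 'u list set"
  const_int :: "'w \<Rightarrow> 'c \<Rightarrow> 'u"

definition is_frame :: "('w, 'u, 'z) frame_scheme \<Rightarrow> bool" where
  "is_frame F \<longleftrightarrow> worlds F \<noteq> {} \<and> acc F \<subseteq> worlds F \<times> worlds F \<and> outer F \<noteq> {} \<and>
     (\<forall>w \<in> worlds F. inner F w \<subseteq> outer F)"

definition is_model :: "('p \<Rightarrow> nat) \<Rightarrow> ('w, 'u, 'p, 'c) model \<Rightarrow> bool" where
  "is_model ar M \<longleftrightarrow> is_frame M \<and>
     (\<forall>w \<in> worlds M. \<forall>P. pred_int M w P \<subseteq> {us. set us \<subseteq> outer M \<and> length us = ar P}) \<and>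
     (\<forall>w \<in> worlds M. \<forall>a. const_int M w a \<in> outer M) \<and>
     (\<forall>w u a. (w, u) \<in> acc M \<longrightarrow> const_int M w a = const_int M u a)"

primrec tm_val :: "('w, 'u, 'p, 'c) model \<Rightarrow> 'w \<Rightarrow> (nat \<Rightarrow> 'u) \<Rightarrow> 'c tm \<Rightarrow> 'u" where
  "tm_val M w \<sigma> (Var x) = \<sigma> x"
| "tm_val M w \<sigma> (Cst a) = const_int M w a"

text \<open>In de Bruijn style, the assignment \<open>\<sigma>[x \<mapsto> d]\<close> for the bound variable \<open>x\<close> is
  \<open>case_nat d \<sigma>\<close>.\<close>

primrec sat :: "('w, 'u, 'p, 'c) model \<Rightarrow> 'w \<Rightarrow> (nat \<Rightarrow> 'u) \<Rightarrow> ('p, 'c) fm \<Rightarrow> bool" where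
  "sat M w \<sigma> (Pos P ts) \<longleftrightarrow> map (tm_val M w \<sigma>) ts \<in> pred_int M w P"
| "sat M w \<sigma> (Neg P ts) \<longleftrightarrow> map (tm_val M w \<sigma>) ts \<notin> pred_int M w P"
| "sat M w \<sigma> (Eq t s) \<longleftrightarrow> tm_val M w \<sigma> t = tm_val M w \<sigma> s"
| "sat M w \<sigma> (Neq t s) \<longleftrightarrow> tm_val M w \<sigma> t \<noteq> tm_val M w \<sigma> s"
| "sat M w \<sigma> (Or \<phi> \<psi>) \<longleftrightarrow> sat M w \<sigma> \<phi> \<or> sat M w \<sigma> \<psi>"
| "sat M w \<sigma> (And \<phi> \<psi>) \<longleftrightarrow> sat M w \<sigma> \<phi> \<and> sat M w \<sigma> \<psi>"
| "sat M w \<sigma> (Ex \<phi>) \<longleftrightarrow> (\<exists>d \<in> inner M w. sat M w (case_nat d \<sigma>) \<phi>)"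
| "sat M w \<sigma> (All \<phi>) \<longleftrightarrow> (\<forall>d \<in> inner M w. sat M w (case_nat d \<sigma>) \<phi>)"
| "sat M w \<sigma> (Dia \<phi>) \<longleftrightarrow> (\<exists>u. (w, u) \<in> acc M \<and> sat M u \<sigma> \<phi>)"
| "sat M w \<sigma> (Box \<phi>) \<longleftrightarrow> (\<forall>u. (w, u) \<in> acc M \<longrightarrow> sat M u \<sigma> \<phi>)"


subsection \<open>Frame conditions\<close>

datatype cond = CondD | CondG nat nat | CondID | CondDD | CondCD | CondNE

primrec cond_holds :: "('w, 'u, 'z) frame_scheme \<Rightarrow> cond \<Rightarrow> bool" where
  "cond_holds F CondD \<longleftrightarrow> (\<forall>w \<in> worlds F. \<exists>u. (w, u) \<in> acc F)"
| "cond_holds F (CondG n k) \<longleftrightarrow>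
     (\<forall>w \<in> worlds F. \<forall>u v. (w, u) \<in> acc F ^^ n \<and> (w, v) \<in> acc F ^^ k \<longrightarrow> (u, v) \<in> acc F)"
| "cond_holds F CondID \<longleftrightarrow> (\<forall>w v. (w, v) \<in> acc F \<longrightarrow> inner F w \<subseteq> inner F v)"
| "cond_holds F CondDD \<longleftrightarrow> (\<forall>w v. (w, v) \<in> acc F \<longrightarrow> inner F v \<subseteq> inner F w)"
| "cond_holds F CondCD \<longleftrightarrow> (\<forall>w \<in> worlds F. inner F w = outer F)"
| "cond_holds F CondNE \<longleftrightarrow> (\<forall>w \<in> worlds F. inner F w \<noteq> {})"

definition in_class :: "cond set \<Rightarrow> ('w, 'u, 'z) frame_scheme \<Rightarrow> bool" where
  "in_class C F \<longleftrightarrow> is_frame F \<and> (\<forall>c \<in> C. cond_holds F c)"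

text \<open>HOL cannot quantify over types inside a formula, so the types \<open>'w\<close> and \<open>'u\<close> that worlds and
  objects are drawn from are parameters; the carriers \<open>worlds\<close> and \<open>outer\<close> range over all
  nonempty subsets of these types. As all conditions are first-order and there are only countably
  many of them, \<open>closed_conds\<close> does not depend on the choice of \<open>'w\<close> and \<open>'u\<close> as long as
  both are infinite (Loewenheim-Skolem).\<close>

definition closed_conds :: "'w itself \<Rightarrow> 'u itself \<Rightarrow> cond set \<Rightarrow> bool" where
  "closed_conds _ _ C \<longleftrightarrow>
     (\<forall>c. (\<forall>F :: ('w, 'u) frame. in_class C F \<longrightarrow> cond_holds F c) \<longrightarrow> c \<in> C)"


subsection \<open>Grammars\<close>

datatype dir = Fw | Bw

type_synonym system = "(dir \<times> dir list) set"

definition derives1 :: "system \<Rightarrow> (dir list \<times> dir list) set" where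
  "derives1 S = {(l @ [c] @ r, l @ s @ r) | l r c s. (c, s) \<in> S}"

definition lang :: "system \<Rightarrow> dir list \<Rightarrow> dir list set" where
  "lang S s = {t. (s, t) \<in> (derives1 S)\<^sup>*}"

definition SG :: "cond set \<Rightarrow> system" where
  "SG C = {(Fw, replicate n Bw @ replicate k Fw) | n k. CondG n k \<in> C} \<union>
          {(Bw, replicate k Bw @ replicate n Fw) | n k. CondG n k \<in> C}"

definition S4 :: system where
  "S4 = {(Fw, []), (Bw, []), (Fw, [Fw, Fw]), (Bw, [Bw, Bw])}"

definition S5 :: system where
  "S5 = {(Fw, []), (Bw, []), (Fw, [Bw, Fw]), (Bw, [Bw, Fw])}"

definition dp_lang :: "cond set \<Rightarrow> dir list set" where
  "dp_lang C =
     (if CondID \<in> C \<and> CondDD \<notin> C then lang (S4 \<union> SG C) [Fw]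
      else if CondDD \<in> C \<and> CondID \<notin> C then lang (S4 \<union> SG C) [Bw]
      else lang S5 [Fw])"


subsection \<open>Nested sequents\<close>

text \<open>\<open>NS ts \<Phi> [H\<^sub>1, \<dots>, H\<^sub>n]\<close> is the nested sequent \<open>ts, \<Phi>, [H\<^sub>1], \<dots>, [H\<^sub>n]\<close>. A component is
  named by its path from the root. Children are kept in a list so that paths are well defined;
  rules that create a child put it in last position. Forgetting the order of children turns a
  derivation here into one on unordered trees, and validity does not depend on that order.\<close>

datatype ('p, 'c) nseq =
  NS (sig: "'c tm multiset") (fms: "('p, 'c) fm multiset") (kids: "('p, 'c) nseq list")

type_synonym name = "nat list"

fun subtree :: "('p, 'c) nseq \<Rightarrow> name \<Rightarrow> ('p, 'c) nseq option" where
  "subtree G [] = Some G"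
| "subtree G (i # p) = (if i < length (kids G) then subtree (kids G ! i) p else None)"

definition names :: "('p, 'c) nseq \<Rightarrow> name set" where
  "names G = {p. subtree G p \<noteq> None}"

definition sig_at :: "('p, 'c) nseq \<Rightarrow> name \<Rightarrow> 'c tm multiset" where
  "sig_at G p = sig (the (subtree G p))"

definition fms_at :: "('p, 'c) nseq \<Rightarrow> name \<Rightarrow> ('p, 'c) fm multiset" where
  "fms_at G p = fms (the (subtree G p))"

text \<open>A context with a hole in component \<open>p\<close> is given by \<open>p\<close> and the sequent \<open>G\<close> obtained by
  removing the hole; \<open>fill p H G\<close> is the result of putting \<open>H\<close> into the hole.\<close>

fun fill :: "name \<Rightarrow> ('p, 'c) nseq \<Rightarrow> ('p, 'c) nseq \<Rightarrow> ('p, 'c) nseq" where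
  "fill [] H G = NS (sig G + sig H) (fms G + fms H) (kids G @ kids H)"
| "fill (i # p) H G = NS (sig G) (fms G) ((kids G)[i := fill p H (kids G ! i)])"

definition fv_nseq :: "('p, 'c) nseq \<Rightarrow> nat set" where
  "fv_nseq G =
     (\<Union>p \<in> names G. (\<Union>t \<in> set_mset (sig_at G p). fv_tm t) \<union> (\<Union>\<phi> \<in> set_mset (fms_at G p). fv \<phi>))"

definition wf_nseq :: "('p \<Rightarrow> nat) \<Rightarrow> ('p, 'c) nseq \<Rightarrow> bool" where
  "wf_nseq ar G \<longleftrightarrow> (\<forall>p \<in> names G. \<forall>\<phi> \<in># fms_at G p. wf_fm ar \<phi>)"

definition is_child :: "('p, 'c) nseq \<Rightarrow> name \<Rightarrow> name \<Rightarrow> bool" where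
  "is_child G w u \<longleftrightarrow> w \<in> names G \<and> u \<in> names G \<and> (\<exists>i. u = w @ [i])"

fun move :: "('p, 'c) nseq \<Rightarrow> dir \<Rightarrow> name \<Rightarrow> name \<Rightarrow> bool" where
  "move G Fw w u \<longleftrightarrow> is_child G w u"
| "move G Bw w u \<longleftrightarrow> is_child G u w"

primrec path :: "('p, 'c) nseq \<Rightarrow> dir list \<Rightarrow> name \<Rightarrow> name \<Rightarrow> bool" where
  "path G [] w u \<longleftrightarrow> w \<in> names G \<and> w = u"
| "path G (c # s) w u \<longleftrightarrow> (\<exists>v. move G c w v \<and> path G s v u)"

definition propagates :: "('p, 'c) nseq \<Rightarrow> dir list set \<Rightarrow> name \<Rightarrow> name \<Rightarrow> bool" where
  "propagates G L w u \<longleftrightarrow> (\<exists>s \<in> L. path G s w u)"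

definition nseq_holds ::
  "('w, 'u, 'p, 'c) model \<Rightarrow> (nat \<Rightarrow> 'u) \<Rightarrow> (name \<Rightarrow> 'w) \<Rightarrow> ('p, 'c) nseq \<Rightarrow> bool" where
  "nseq_holds M \<sigma> \<iota> G \<longleftrightarrow>
     ((\<forall>u v. is_child G u v \<longrightarrow> (\<iota> u, \<iota> v) \<in> acc M) \<and>
      (\<forall>u \<in> names G. \<forall>t \<in># sig_at G u. tm_val M (\<iota> u) \<sigma> t \<in> inner M (\<iota> u)) \<longrightarrow>
      (\<exists>v \<in> names G. \<exists>\<phi> \<in># fms_at G v. sat M (\<iota> v) \<sigma> \<phi>))"

definition valid ::
  "'w itself \<Rightarrow> 'u itself \<Rightarrow> ('p \<Rightarrow> nat) \<Rightarrow> cond set \<Rightarrow> ('p, 'c) nseq \<Rightarrow> bool" where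
  "valid _ _ ar C G \<longleftrightarrow>
     (\<forall>(M :: ('w, 'u, 'p, 'c) model) \<sigma> \<iota>.
        is_model ar M \<and> in_class C M \<and> range \<sigma> \<subseteq> outer M \<and> range \<iota> \<subseteq> worlds M \<longrightarrow>
        nseq_holds M \<sigma> \<iota> G)"


subsection \<open>The calculus\<close>

abbreviation tms_fms :: "'c tm multiset \<Rightarrow> ('p, 'c) fm multiset \<Rightarrow> ('p, 'c) nseq" where
  "tms_fms T \<Phi> \<equiv> NS T \<Phi> []"

abbreviation tms :: "'c tm multiset \<Rightarrow> ('p, 'c) nseq" where
  "tms T \<equiv> NS T {#} []"

abbreviation fmls :: "('p, 'c) fm multiset \<Rightarrow> ('p, 'c) nseq" where
  "fmls \<Phi> \<equiv> NS {#} \<Phi> []"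

abbreviation boxed :: "('p, 'c) nseq \<Rightarrow> ('p, 'c) nseq" where
  "boxed H \<equiv> NS {#} {#} [H]"

text \<open>No rule mentions arities: a premise of a rule instance with a well-formed conclusion
  is itself well-formed.\<close>

inductive provable :: "cond set \<Rightarrow> ('p, 'c) nseq \<Rightarrow> bool" for C :: "cond set" where
  ax: "p \<in> names G \<Longrightarrow> is_literal L \<Longrightarrow> provable C (fill p (fmls {#L, neg L#}) G)"
| disj: "p \<in> names G \<Longrightarrow> provable C (fill p (fmls {#\<phi>, \<psi>#}) G) \<Longrightarrow>
    provable C (fill p (fmls {#Or \<phi> \<psi>#}) G)"
| conj: "p \<in> names G \<Longrightarrow> provable C (fill p (fmls {#\<phi>#}) G) \<Longrightarrow>
    provable C (fill p (fmls {#\<psi>#}) G) \<Longrightarrow> provable C (fill p (fmls {#And \<phi> \<psi>#}) G)"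
| ex: "p \<in> names G \<Longrightarrow> provable C (fill p (tms_fms {#t#} {#Ex \<psi>, inst t \<psi>#}) G) \<Longrightarrow>
    provable C (fill p (tms_fms {#t#} {#Ex \<psi>#}) G)"
| all: "p \<in> names G \<Longrightarrow> y \<notin> fv_nseq (fill p (fmls {#All \<phi>#}) G) \<Longrightarrow>
    provable C (fill p (tms_fms {#Var y#} {#inst (Var y) \<phi>#}) G) \<Longrightarrow>
    provable C (fill p (fmls {#All \<phi>#}) G)"
| dia: "w \<in> names G \<Longrightarrow> u \<in> names G \<Longrightarrow> propagates G (lang (SG C) [Fw]) w u \<Longrightarrow>
    provable C (fill w (fmls {#Dia \<phi>#}) (fill u (fmls {#\<phi>#}) G)) \<Longrightarrow>
    provable C (fill w (fmls {#Dia \<phi>#}) G)"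
| box: "p \<in> names G \<Longrightarrow> provable C (fill p (boxed (fmls {#\<phi>#})) G) \<Longrightarrow>
    provable C (fill p (fmls {#Box \<phi>#}) G)"
| ref: "p \<in> names G \<Longrightarrow> provable C (fill p (fmls {#Neq t t#}) G) \<Longrightarrow> provable C G"
| rep: "p \<in> names G \<Longrightarrow> is_negative_literal N \<Longrightarrow>
    provable C (fill p (fmls {#Neq t s, subst_var t z N, subst_var s z N#}) G) \<Longrightarrow>
    provable C (fill p (fmls {#Neq t s, subst_var t z N#}) G)"
| drep: "p \<in> names G \<Longrightarrow> provable C (fill p (tms_fms {#s, t#} {#Neq t s#}) G) \<Longrightarrow>
    provable C (fill p (tms_fms {#t#} {#Neq t s#}) G)"
| rig: "w \<in> names G \<Longrightarrow> u \<in> names G \<Longrightarrow> w \<noteq> u \<Longrightarrow>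
    provable C (fill w (fmls {#Neq s t#}) (fill u (fmls {#Neq s t#}) G)) \<Longrightarrow>
    provable C (fill w (fmls {#Neq s t#}) G)"
| dp: "CondID \<in> C \<or> CondDD \<in> C \<Longrightarrow> w \<in> names G \<Longrightarrow> u \<in> names G \<Longrightarrow> w \<noteq> u \<Longrightarrow>
    propagates G (dp_lang C) w u \<Longrightarrow>
    provable C (fill w (tms {#t#}) (fill u (tms {#t#}) G)) \<Longrightarrow>
    provable C (fill w (tms {#t#}) G)"
| d: "CondD \<in> C \<Longrightarrow> p \<in> names G \<Longrightarrow> provable C (fill p (boxed (NS {#} {#} [])) G) \<Longrightarrow>
    provable C G"
| nd: "CondNE \<in> C \<Longrightarrow> p \<in> names G \<Longrightarrow> y \<notin> fv_nseq G \<Longrightarrow>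
    provable C (fill p (tms {#Var y#}) G) \<Longrightarrow> provable C G"
| cd: "CondCD \<in> C \<Longrightarrow> p \<in> names G \<Longrightarrow> provable C (fill p (tms {#t#}) G) \<Longrightarrow> provable C G"

end

theory Submission
  imports Defs "HOL-Library.Countable_Set"
begin

text \<open>If \<open>G\<close> is unprovable, each backward rule application to it has an unprovable premise; doing so
  fairly yields in the limit an infinite tree of components. They are the worlds of a countermodel,
  with \<open>w R u\<close> iff \<open>u\<close> is reachable from \<open>w\<close> along a word of
  the language of the grammar \<open>S(G)\<close> started at \<open>f\<close>; this relation satisfies \<open>G(n,k)\<close> because \<open>f \<rightarrow> b\<^sup>n f\<^sup>k\<close> is a
  production and the grammar is closed under reversing words and swapping \<open>f\<close> and \<open>b\<close>. The objects
  are the terms modulo \<open>t \<noteq> s\<close> occurring in the tree, and the inner domain of a component is given by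
  its signature. Every formula of the tree is false in this model. All stages are finite, so the
  model is countable and fits into any infinite types of worlds and objects.\<close>

subsection \<open>Components of nested sequents\<close>

text \<open>The types of predicates and constants are arbitrary, possibly uncountable, so fairness
  cannot rest on an enumeration of all formulas and terms. Instead, a state wants only finitely many
  goals, all one step away from what is present, and each stage of the chain achieves every goal
  wanted at the stage before. The order within a stage is immaterial, because extensions preserve
  both that a goal is wanted and that it is achieved. Variables have one value in all worlds and
  constants must be rigid, so terms can only be identified globally. The rule \<open>rig\<close>
  copies every disequality to all components, which allows equality to be read off at the root;
  \<open>ref\<close> gives reflexivity, and \<open>rep\<close> applied to disequalities gives the
  Euclidean property, together an equivalence. Since \<open>rep\<close> rewrites negative literals
  only, a positive literal is refuted indirectly: a negated atom that would make it true can be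
  rewritten into its exact negation, and the two together would be an axiom.\<close>

definition tm_in :: "('p, 'c) nseq \<Rightarrow> name \<Rightarrow> 'c tm \<Rightarrow> bool" where
  "tm_in K p t \<longleftrightarrow> p \<in> names K \<and> t \<in># sig_at K p"

definition fm_in :: "('p, 'c) nseq \<Rightarrow> name \<Rightarrow> ('p, 'c) fm \<Rightarrow> bool" where
  "fm_in K p \<chi> \<longleftrightarrow> p \<in> names K \<and> \<chi> \<in># fms_at K p"

lemma Nil_in_names [simp]: "[] \<in> names K"
  by (simp add: names_def)

lemma Cons_in_names [simp]: "i # p \<in> names K \<longleftrightarrow> i < length (kids K) \<and> p \<in> names (kids K ! i)"
  by (simp add: names_def)

lemma names_eq: "names K = insert [] (\<Union>i < length (kids K). (#) i ` names (kids K ! i))"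
proof (rule set_eqI)
  fix p show "p \<in> names K \<longleftrightarrow> p \<in> insert [] (\<Union>i < length (kids K). (#) i ` names (kids K ! i))"
    by (cases p) auto
qed

lemma finite_names: "finite (names K)"
proof (induction K)
  case (NS T \<Phi> Hs)
  then show ?case by (subst names_eq) auto
qed

lemma tm_in_Nil [simp]: "tm_in K [] t \<longleftrightarrow> t \<in># sig K"
  by (simp add: tm_in_def sig_at_def)

lemma tm_in_Cons [simp]:
  "tm_in K (i # p) t \<longleftrightarrow> i < length (kids K) \<and> tm_in (kids K ! i) p t"
  by (auto simp: tm_in_def sig_at_def)

lemma fm_in_Nil [simp]: "fm_in K [] \<chi> \<longleftrightarrow> \<chi> \<in># fms K"
  by (simp add: fm_in_def fms_at_def)

lemma fm_in_Cons [simp]: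
  "fm_in K (i # p) \<chi> \<longleftrightarrow> i < length (kids K) \<and> fm_in (kids K ! i) p \<chi>"
  by (auto simp: fm_in_def fms_at_def)

section \<open>Effect of filling a hole on names, signatures and formulas\<close>

lemma names_fill:
  "p \<in> names G \<Longrightarrow> q \<in> names (fill p (NS T \<Phi> []) G) \<longleftrightarrow> q \<in> names G"
proof (induction p arbitrary: G q)
  case Nil
  then show ?case by (cases q) auto
next
  case (Cons i p)
  then show ?case by (cases q) (auto simp: nth_list_update)
qed

lemma tm_in_fill:
  "p \<in> names G \<Longrightarrow> tm_in (fill p (NS T \<Phi> []) G) q t \<longleftrightarrow> tm_in G q t \<or> (q = p \<and> t \<in># T)"
proof (induction p arbitrary: G q)
  case Nil
  then show ?case by (cases q) auto
next
  case (Cons i p)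
  then show ?case by (cases q) (auto simp: nth_list_update)
qed

lemma fm_in_fill:
  "p \<in> names G \<Longrightarrow> fm_in (fill p (NS T \<Phi> []) G) q \<chi> \<longleftrightarrow> fm_in G q \<chi> \<or> (q = p \<and> \<chi> \<in># \<Phi>)"
proof (induction p arbitrary: G q)
  case Nil
  then show ?case by (cases q) auto
next
  case (Cons i p)
  then show ?case by (cases q) (auto simp: nth_list_update)
qed

lemmas in_fill = names_fill tm_in_fill fm_in_fill

text \<open>The new child is put last, so every existing component keeps its path; this makes names
  comparable between the stages of the chain. The index \<open>k\<close> is the former number of
  children of \<open>p\<close>.\<close>

lemma in_fill_boxed:
  assumes "p \<in> names G"
  shows "\<exists>k. p @ [k] \<notin> names G \<and>
    (\<forall>q. q \<in> names (fill p (boxed (fmls \<Phi>)) G) \<longleftrightarrow> q \<in> names G \<or> q = p @ [k]) \<and>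
    (\<forall>q t. tm_in (fill p (boxed (fmls \<Phi>)) G) q t \<longleftrightarrow> tm_in G q t) \<and>
    (\<forall>q \<chi>. fm_in (fill p (boxed (fmls \<Phi>)) G) q \<chi> \<longleftrightarrow> fm_in G q \<chi> \<or> (q = p @ [k] \<and> \<chi> \<in># \<Phi>))"
  using assms
proof (induction p arbitrary: G)
  case Nil
  let ?k = "length (kids G)"
  have leaf: "q \<in> names (fmls \<Phi>) \<longleftrightarrow> q = []" "tm_in (fmls \<Phi>) q t \<longleftrightarrow> False"
    "fm_in (fmls \<Phi>) q \<chi> \<longleftrightarrow> q = [] \<and> \<chi> \<in># \<Phi>" for q t \<chi>
    by (cases q; simp)+
  have "(q \<in> names (fill [] (boxed (fmls \<Phi>)) G) \<longleftrightarrow> q \<in> names G \<or> q = [?k]) \<and>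
    (tm_in (fill [] (boxed (fmls \<Phi>)) G) q t \<longleftrightarrow> tm_in G q t) \<and>
    (fm_in (fill [] (boxed (fmls \<Phi>)) G) q \<chi> \<longleftrightarrow> fm_in G q \<chi> \<or> (q = [?k] \<and> \<chi> \<in># \<Phi>))" for q t \<chi>
    by (cases q) (auto simp: nth_append less_Suc_eq leaf split: if_splits)
  then show ?case by (intro exI[of _ ?k]) auto
next
  case (Cons i p)
  then have i: "i < length (kids G)" and p: "p \<in> names (kids G ! i)"
    by auto
  let ?H = "fill p (boxed (fmls \<Phi>)) (kids G ! i)"
  obtain k where k: "p @ [k] \<notin> names (kids G ! i)"
    "\<And>q. q \<in> names ?H \<longleftrightarrow> q \<in> names (kids G ! i) \<or> q = p @ [k]"
    "\<And>q t. tm_in ?H q t \<longleftrightarrow> tm_in (kids G ! i) q t"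
    "\<And>q \<chi>. fm_in ?H q \<chi> \<longleftrightarrow> fm_in (kids G ! i) q \<chi> \<or> (q = p @ [k] \<and> \<chi> \<in># \<Phi>)"
    using Cons.IH[OF p] by auto
  have "(q \<in> names (fill (i # p) (boxed (fmls \<Phi>)) G) \<longleftrightarrow> q \<in> names G \<or> q = (i # p) @ [k]) \<and>
    (tm_in (fill (i # p) (boxed (fmls \<Phi>)) G) q t \<longleftrightarrow> tm_in G q t) \<and>
    (fm_in (fill (i # p) (boxed (fmls \<Phi>)) G) q \<chi> \<longleftrightarrow>
      fm_in G q \<chi> \<or> (q = (i # p) @ [k] \<and> \<chi> \<in># \<Phi>))" for q t \<chi>
    using i by (cases q) (auto simp: nth_list_update k split: if_splits)
  then show ?case using i k(1) by (intro exI[of _ k]) auto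
qed

text \<open>Rules are stated for sequents of the form \<open>fill p H G\<close>, so the principal
  terms and formulas have to be cut out of \<open>K\<close> before a rule can be read backward.
  Cutting does not change the tree, and \<open>names G = names K\<close> transfers the propagation
  side conditions, which speak about the context.\<close>

lemma ex_context:
  assumes "p \<in> names K" "T \<subseteq># sig_at K p" "\<Phi> \<subseteq># fms_at K p"
  shows "\<exists>G. K = fill p (NS T \<Phi> []) G \<and> names G = names K"
  using assms
proof (induction p arbitrary: K)
  case Nil
  let ?G = "NS (sig K - T) (fms K - \<Phi>) (kids K)"
  have "K = fill [] (NS T \<Phi> []) ?G"
    using Nil by (simp add: sig_at_def fms_at_def)
  moreover have "names ?G = names K"
    by (simp add: names_eq[of K] names_eq[of ?G])
  ultimately show ?case by blast
next
  case (Cons i p)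
  then have i: "i < length (kids K)" by auto
  obtain H where H: "kids K ! i = fill p (NS T \<Phi> []) H" "names H = names (kids K ! i)"
    using Cons.IH[of "kids K ! i"] Cons.prems by (auto simp: sig_at_def fms_at_def)
  let ?G = "NS (sig K) (fms K) ((kids K)[i := H])"
  have "K = fill (i # p) (NS T \<Phi> []) ?G"
    using i by (cases K) (simp add: H(1)[symmetric])
  moreover have "names ?G = names K"
    using i by (auto simp: names_eq[of K] names_eq[of ?G] nth_list_update H(2) split: if_splits)
  ultimately show ?case by blast
qed

lemma ex_context_fm:
  assumes "fm_in K p \<chi>"
  obtains G where "K = fill p (fmls {#\<chi>#}) G" "names G = names K" "p \<in> names G"
  using ex_context[of p K "{#}" "{#\<chi>#}"] assms by (auto simp: fm_in_def)

lemma ex_context_tm: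
  assumes "tm_in K p t"
  obtains G where "K = fill p (tms {#t#}) G" "names G = names K" "p \<in> names G"
  using ex_context[of p K "{#t#}" "{#}"] assms by (auto simp: tm_in_def)

lemma ex_context_tm_fm:
  assumes "tm_in K p t" "fm_in K p \<chi>"
  obtains G where "K = fill p (tms_fms {#t#} {#\<chi>#}) G" "names G = names K" "p \<in> names G"
  using ex_context[of p K "{#t#}" "{#\<chi>#}"] assms by (auto simp: tm_in_def fm_in_def)

text \<open>Components are multisets, so equal formulas would have to be present twice; distinctness
  rules this out.\<close>

lemma ex_context_fm2:
  assumes "fm_in K p \<chi>" "fm_in K p \<psi>" "\<chi> \<noteq> \<psi>"
  obtains G where "K = fill p (fmls {#\<chi>, \<psi>#}) G" "names G = names K" "p \<in> names G"
proof -
  have "{#\<chi>, \<psi>#} \<subseteq># fms_at K p"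
    using assms by (auto simp: fm_in_def insert_subset_eq_iff in_diff_count)
  then show ?thesis
    using that ex_context[of p K "{#}" "{#\<chi>, \<psi>#}"] assms by (auto simp: fm_in_def)
qed

lemma finite_fv_tm: "finite (fv_tm t)"
  by (cases t) auto

lemma finite_fv: "finite (fv \<phi>)"
proof (induction \<phi>)
  case (Ex \<phi>)
  have "{n. Suc n \<in> fv \<phi>} = Suc -` fv \<phi>" by auto
  then show ?case using Ex by (simp add: finite_vimageI)
next
  case (All \<phi>)
  have "{n. Suc n \<in> fv \<phi>} = Suc -` fv \<phi>" by auto
  then show ?case using All by (simp add: finite_vimageI)
qed (auto simp: finite_fv_tm)

lemma ex_fresh: "\<exists>y. y \<notin> fv_nseq K"
proof -
  have "finite (fv_nseq K)"
    by (auto simp: fv_nseq_def finite_names finite_fv finite_fv_tm)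
  then show ?thesis by (meson ex_new_if_finite infinite_UNIV_nat)
qed

lemma move_mono: "names K \<subseteq> names K' \<Longrightarrow> move K c w u \<Longrightarrow> move K' c w u"
  by (cases c) (auto simp: is_child_def)

lemma path_mono: "names K \<subseteq> names K' \<Longrightarrow> path K s w u \<Longrightarrow> path K' s w u"
  by (induction s arbitrary: w) (auto intro: move_mono)

lemma propagates_mono: "names K \<subseteq> names K' \<Longrightarrow> propagates K L w u \<Longrightarrow> propagates K' L w u"
  by (auto simp: propagates_def intro: path_mono)

lemma path_in_names: "path K s w u \<Longrightarrow> w \<in> names K \<and> u \<in> names K"
proof (induction s arbitrary: w)
  case (Cons c s)
  then show ?case by (cases c) (auto simp: is_child_def)
qed simp

lemma propagates_in_names: "propagates K L w u \<Longrightarrow> u \<in> names K"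
  by (auto simp: propagates_def dest: path_in_names)

lemma wf_subst [simp]: "wf_fm ar (subst \<theta> \<phi>) \<longleftrightarrow> wf_fm ar \<phi>"
  by (induction \<phi> arbitrary: \<theta>) auto

lemma wf_inst [simp]: "wf_fm ar (inst t \<phi>) \<longleftrightarrow> wf_fm ar \<phi>"
  by (simp add: inst_def)

lemma subst_tm_upd_fresh: "z \<notin> fv_tm t \<Longrightarrow> subst_tm (Var(z := s)) t = t"
  by (cases t) auto

subsection \<open>Refutation states\<close>

text \<open>The rules for \<open>\<or>\<close>, \<open>\<and>\<close>, \<open>\<forall>\<close> and \<open>\<box>\<close> consume their principal formula. A state therefore pairs
  the unprovable sequent \<open>K\<close> with the set \<open>F p\<close> of all formulas that have ever occurred in component
  \<open>p\<close>, which makes the extension order on states transitive.\<close>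

fun reduced ::
  "('p, 'c) nseq \<Rightarrow> (name \<Rightarrow> ('p, 'c) fm set) \<Rightarrow> name \<Rightarrow> ('p, 'c) fm \<Rightarrow> bool" where
  "reduced K F p (Or \<phi> \<psi>) \<longleftrightarrow> \<phi> \<in> F p \<and> \<psi> \<in> F p"
| "reduced K F p (And \<phi> \<psi>) \<longleftrightarrow> \<phi> \<in> F p \<or> \<psi> \<in> F p"
| "reduced K F p (All \<phi>) \<longleftrightarrow> (\<exists>y. tm_in K p (Var y) \<and> inst (Var y) \<phi> \<in> F p)"
| "reduced K F p (Box \<phi>) \<longleftrightarrow> (\<exists>i. p @ [i] \<in> names K \<and> \<phi> \<in> F (p @ [i]))"
| "reduced K F p _ \<longleftrightarrow> False"

primrec reducible :: "('p, 'c) fm \<Rightarrow> bool" where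
  "reducible (Pos P ts) \<longleftrightarrow> False"
| "reducible (Neg P ts) \<longleftrightarrow> False"
| "reducible (Eq t s) \<longleftrightarrow> False"
| "reducible (Neq t s) \<longleftrightarrow> False"
| "reducible (Or \<phi> \<psi>) \<longleftrightarrow> True"
| "reducible (And \<phi> \<psi>) \<longleftrightarrow> True"
| "reducible (Ex \<phi>) \<longleftrightarrow> False"
| "reducible (All \<phi>) \<longleftrightarrow> True"
| "reducible (Dia \<phi>) \<longleftrightarrow> False"
| "reducible (Box \<phi>) \<longleftrightarrow> True"

definition state ::
  "cond set \<Rightarrow> ('p \<Rightarrow> nat) \<Rightarrow> ('p, 'c) nseq \<Rightarrow> (name \<Rightarrow> ('p, 'c) fm set) \<Rightarrow> bool" where
  "state C ar K F \<longleftrightarrow> \<not> provable C K \<and>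
     (\<forall>p \<chi>. fm_in K p \<chi> \<longrightarrow> \<chi> \<in> F p) \<and>
     (\<forall>p. \<forall>\<chi> \<in> F p. p \<in> names K \<and> wf_fm ar \<chi> \<and> (fm_in K p \<chi> \<or> reduced K F p \<chi>)) \<and>
     (\<forall>p. finite (F p))"

definition extends ::
  "('p, 'c) nseq \<Rightarrow> (name \<Rightarrow> ('p, 'c) fm set) \<Rightarrow> ('p, 'c) nseq \<Rightarrow> (name \<Rightarrow> ('p, 'c) fm set) \<Rightarrow> bool"
  where
  "extends K F K' F' \<longleftrightarrow> names K \<subseteq> names K' \<and> (\<forall>p t. tm_in K p t \<longrightarrow> tm_in K' p t) \<and> (\<forall>p. F p \<subseteq> F' p)"

lemma extends_refl: "extends K F K F"
  by (simp add: extends_def)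

lemma extends_trans: "extends K F K' F' \<Longrightarrow> extends K' F' K'' F'' \<Longrightarrow> extends K F K'' F''"
  unfolding extends_def by blast

lemma reduced_mono:
  assumes "extends K F K' F'" "reduced K F p \<chi>"
  shows "reduced K' F' p \<chi>"
  using assms unfolding extends_def by (cases \<chi>; simp; blast)

text \<open>Formulas that are not reducible are never consumed: \<open>reduced\<close> is false of
  them, so the invariant leaves only their presence in the current sequent.\<close>

lemma state_fm_in:
  "state C ar K F \<Longrightarrow> \<chi> \<in> F p \<Longrightarrow> \<not> reducible \<chi> \<Longrightarrow> fm_in K p \<chi>"
  by (cases \<chi>) (force simp: state_def)+

text \<open>A formula may leave the sequent only if the new sequent contains what reduces it. This
  is demanded for the formulas of \<open>K'\<close> alone, as \<open>F'\<close> is only built here,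
  by adding them to \<open>F\<close>; monotonicity of \<open>reduced\<close> carries it over to
  \<open>F'\<close>.\<close>

lemma state_step:
  assumes st: "state C ar K F"
    and "\<not> provable C K'" "names K \<subseteq> names K'" "\<And>p t. tm_in K p t \<Longrightarrow> tm_in K' p t"
    and fm: "\<And>p \<chi>. fm_in K p \<chi> \<Longrightarrow> fm_in K' p \<chi> \<or> reduced K' (\<lambda>p. {\<chi>. fm_in K' p \<chi>}) p \<chi>"
    and wf: "\<And>p \<chi>. fm_in K' p \<chi> \<Longrightarrow> fm_in K p \<chi> \<or> wf_fm ar \<chi>"
  obtains F' where "state C ar K' F'" "extends K F K' F'" "\<And>p \<chi>. fm_in K' p \<chi> \<Longrightarrow> \<chi> \<in> F' p"
proof -
  define F' where "F' p = F p \<union> {\<chi>. fm_in K' p \<chi>}" for p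
  have ext: "extends K F K' F'"
    using assms by (auto simp: extends_def F'_def)
  have ext': "extends K' (\<lambda>p. {\<chi>. fm_in K' p \<chi>}) K' F'"
    by (auto simp: extends_def F'_def)
  have fin: "finite {\<chi>. fm_in K' p \<chi>}" for p
    by (rule finite_subset[of _ "set_mset (fms_at K' p)"]) (auto simp: fm_in_def)
  have "p \<in> names K' \<and> wf_fm ar \<chi> \<and> (fm_in K' p \<chi> \<or> reduced K' F' p \<chi>)" if "\<chi> \<in> F' p" for p \<chi>
  proof (cases "\<chi> \<in> F p")
    case True
    then have "p \<in> names K" "wf_fm ar \<chi>" "fm_in K p \<chi> \<or> reduced K F p \<chi>"
      using st by (auto simp: state_def)
    then show ?thesis
      using assms(3) fm reduced_mono[OF ext] reduced_mono[OF ext'] by blast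
  next
    case False
    then have "fm_in K' p \<chi>" using that by (simp add: F'_def)
    then show ?thesis using wf[of p \<chi>] False st by (auto simp: state_def fm_in_def)
  qed
  then have "state C ar K' F'"
    using st assms(2) fin by (auto simp: state_def F'_def)
  then show thesis using ext that by (auto simp: F'_def)
qed

section \<open>Goals and their persistence\<close>

text \<open>\<open>AddKid\<close> and \<open>AddSome\<close> leave the child and the term open,
  because the step that achieves them chooses these; \<open>Reduce\<close> likewise leaves open the
  conjunct, the eigenvariable or the new child.\<close>

datatype ('p, 'c) goal =
    Reduce name "('p, 'c) fm"
  | AddFm name "('p, 'c) fm"
  | AddTm name "'c tm"
  | AddKid name
  | AddSome name

primrec achieved ::
  "('p, 'c) nseq \<Rightarrow> (name \<Rightarrow> ('p, 'c) fm set) \<Rightarrow> ('p, 'c) goal \<Rightarrow> bool" where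
  "achieved K F (Reduce p \<chi>) \<longleftrightarrow> reduced K F p \<chi>"
| "achieved K F (AddFm p \<chi>) \<longleftrightarrow> \<chi> \<in> F p"
| "achieved K F (AddTm p t) \<longleftrightarrow> tm_in K p t"
| "achieved K F (AddKid p) \<longleftrightarrow> (\<exists>i. p @ [i] \<in> names K)"
| "achieved K F (AddSome p) \<longleftrightarrow> (\<exists>t. tm_in K p t)"

lemma achieved_mono: "extends K F K' F' \<Longrightarrow> achieved K F g \<Longrightarrow> achieved K' F' g"
proof (cases g)
  case (Reduce p \<chi>)
  then show "extends K F K' F' \<Longrightarrow> achieved K F g \<Longrightarrow> achieved K' F' g"
    using reduced_mono by auto
qed (auto simp: extends_def)

text \<open>Compound formulas contribute nothing, so an index bound by a quantifier is never
  mistaken for a variable of the sequent. Their terms enter the equality reasoning when they surface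
  in a literal.\<close>

primrec literal_tms :: "('p, 'c) fm \<Rightarrow> 'c tm set" where
  "literal_tms (Pos P ts) = set ts"
| "literal_tms (Neg P ts) = set ts"
| "literal_tms (Eq t s) = {t, s}"
| "literal_tms (Neq t s) = {t, s}"
| "literal_tms (Or \<phi> \<psi>) = {}"
| "literal_tms (And \<phi> \<psi>) = {}"
| "literal_tms (Ex \<phi>) = {}"
| "literal_tms (All \<phi>) = {}"
| "literal_tms (Dia \<phi>) = {}"
| "literal_tms (Box \<phi>) = {}"

lemma finite_literal_tms: "finite (literal_tms \<phi>)"
  by (cases \<phi>) auto

text \<open>Reflexivity is only demanded for terms that occur, so that every state has finitely many goals.
  In \<open>eucl\<close>, the case \<open>r = t\<close> is symmetry.\<close>

inductive wanted ::
  "cond set \<Rightarrow> ('p, 'c) nseq \<Rightarrow> (name \<Rightarrow> ('p, 'c) fm set) \<Rightarrow> ('p, 'c) goal \<Rightarrow> bool"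
  for C K F where
  reduce: "\<chi> \<in> F p \<Longrightarrow> reducible \<chi> \<Longrightarrow> wanted C K F (Reduce p \<chi>)"
| ex: "Ex \<phi> \<in> F p \<Longrightarrow> tm_in K p t \<Longrightarrow> wanted C K F (AddFm p (inst t \<phi>))"
| dia: "Dia \<phi> \<in> F w \<Longrightarrow> propagates K (lang (SG C) [Fw]) w u \<Longrightarrow> wanted C K F (AddFm u \<phi>)"
| ref_lit: "\<chi> \<in> F p \<Longrightarrow> t \<in> literal_tms \<chi> \<Longrightarrow> wanted C K F (AddFm [] (Neq t t))"
| ref_sig: "tm_in K p t \<Longrightarrow> wanted C K F (AddFm [] (Neq t t))"
| ref_var: "wanted C K F (AddFm [] (Neq (Var 0) (Var 0)))"
| eucl: "Neq t s \<in> F p \<Longrightarrow> Neq t r \<in> F p \<Longrightarrow> wanted C K F (AddFm p (Neq s r))"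
| rep: "Neq (ts ! i) s \<in> F p \<Longrightarrow> Neg P ts \<in> F p \<Longrightarrow> i < length ts \<Longrightarrow>
    wanted C K F (AddFm p (Neg P (ts[i := s])))"
| rig: "Neq s t \<in> F w \<Longrightarrow> u \<in> names K \<Longrightarrow> wanted C K F (AddFm u (Neq s t))"
| dp: "CondID \<in> C \<or> CondDD \<in> C \<Longrightarrow> tm_in K w t \<Longrightarrow> propagates K (dp_lang C) w u \<Longrightarrow>
    wanted C K F (AddTm u t)"
| d: "CondD \<in> C \<Longrightarrow> p \<in> names K \<Longrightarrow> wanted C K F (AddKid p)"
| nd: "CondNE \<in> C \<Longrightarrow> p \<in> names K \<Longrightarrow> wanted C K F (AddSome p)"
| cd: "CondCD \<in> C \<Longrightarrow> p \<in> names K \<Longrightarrow> Neq t t \<in> F [] \<Longrightarrow> wanted C K F (AddTm p t)"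

text \<open>The conditions in \<open>wanted\<close> are positive in the state, so pursuing one goal
  never cancels another.\<close>

lemma wanted_mono:
  assumes "extends K F K' F'" "wanted C K F g"
  shows "wanted C K' F' g"
proof -
  have F: "\<And>p \<chi>. \<chi> \<in> F p \<Longrightarrow> \<chi> \<in> F' p" and S: "\<And>p t. tm_in K p t \<Longrightarrow> tm_in K' p t"
    and N: "\<And>p. p \<in> names K \<Longrightarrow> p \<in> names K'"
    and pr: "\<And>L w u. propagates K L w u \<Longrightarrow> propagates K' L w u"
    using assms(1) by (auto simp: extends_def intro: propagates_mono)
  show ?thesis
    using assms(2) by induction (blast intro: wanted.intros F S N pr)+
qed

section \<open>Every wanted goal can be achieved\<close>

text \<open>If the formula has already been consumed, the invariant says that it is reduced.
  Otherwise its rule has an unprovable premise; for \<open>And\<close> this decides which conjunct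
  to keep.\<close>

lemma achieve_reduce:
  assumes st: "state C ar K F" and \<chi>: "\<chi> \<in> F p" "reducible \<chi>"
  shows "\<exists>K' F'. state C ar K' F' \<and> extends K F K' F' \<and> reduced K' F' p \<chi>"
proof (cases "fm_in K p \<chi>")
  case False
  then show ?thesis using st \<chi> extends_refl unfolding state_def by blast
next
  case True
  then obtain G where K: "K = fill p (fmls {#\<chi>#}) G" and G: "names G = names K" "p \<in> names G"
    by (rule ex_context_fm)
  have unprov: "\<not> provable C K" and wf: "wf_fm ar \<chi>"
    using st \<chi> by (auto simp: state_def)
  \<comment> \<open>Common end of all cases: \<open>K'\<close> is a premise built over the context
    \<open>G\<close>, from which the principal formula has been removed. Only that formula can
    disappear, and it is reduced in \<open>K'\<close>.\<close>
  have finish: ?thesis if K': "\<not> provable C K'" "names K \<subseteq> names K'" "\<And>q t. tm_in G q t \<Longrightarrow> tm_in K' q t"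
    "\<And>q \<psi>. fm_in G q \<psi> \<Longrightarrow> fm_in K' q \<psi>" "reduced K' (\<lambda>p. {\<chi>. fm_in K' p \<chi>}) p \<chi>"
    "\<And>q \<psi>. fm_in K' q \<psi> \<Longrightarrow> fm_in G q \<psi> \<or> wf_fm ar \<psi>" for K'
  proof -
    have fm: "fm_in K' q \<psi> \<or> reduced K' (\<lambda>p. {\<chi>. fm_in K' p \<chi>}) q \<psi>" if "fm_in K q \<psi>" for q \<psi>
      using that K' G(2) by (auto simp: K in_fill)
    have tm: "tm_in K' q t" if "tm_in K q t" for q t
      using that K' G(2) by (auto simp: K in_fill)
    have wf': "fm_in K q \<psi> \<or> wf_fm ar \<psi>" if "fm_in K' q \<psi>" for q \<psi>
      using K'(6)[OF that] G(2) by (auto simp: K in_fill)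
    obtain F' where F': "state C ar K' F'" "extends K F K' F'"
      "\<And>p \<chi>. fm_in K' p \<chi> \<Longrightarrow> \<chi> \<in> F' p"
      using state_step[OF st K'(1,2) tm fm wf'] by blast
    then have "extends K' (\<lambda>p. {\<chi>. fm_in K' p \<chi>}) K' F'" by (auto simp: extends_def)
    then show ?thesis using reduced_mono K'(5) F' by blast
  qed
  show ?thesis
  proof (cases \<chi>)
    case (Or \<phi> \<psi>)
    have "\<not> provable C (fill p (fmls {#\<phi>, \<psi>#}) G)"
      using unprov G(2) by (auto simp: K Or intro: provable.disj)
    then show ?thesis
      by (rule finish) (use wf G in \<open>auto simp: Or in_fill\<close>)
  next
    case (And \<phi> \<psi>)
    have "\<not> provable C (fill p (fmls {#\<phi>#}) G) \<or> \<not> provable C (fill p (fmls {#\<psi>#}) G)"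
      using unprov G(2) by (auto simp: K And intro: provable.conj)
    then show ?thesis
    proof
      assume "\<not> provable C (fill p (fmls {#\<phi>#}) G)"
      then show ?thesis by (rule finish) (use wf G in \<open>auto simp: And in_fill\<close>)
    next
      assume "\<not> provable C (fill p (fmls {#\<psi>#}) G)"
      then show ?thesis by (rule finish) (use wf G in \<open>auto simp: And in_fill\<close>)
    qed
  next
    case (All \<phi>)
    obtain y where "y \<notin> fv_nseq K" using ex_fresh by blast
    then have "\<not> provable C (fill p (tms_fms {#Var y#} {#inst (Var y) \<phi>#}) G)"
      using unprov G(2) by (auto simp: K All intro: provable.all)
    then show ?thesis
      by (rule finish) (use wf G in \<open>auto simp: All in_fill\<close>)
  next
    case (Box \<phi>)
    let ?K = "fill p (boxed (fmls {#\<phi>#})) G"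
    have unprov': "\<not> provable C ?K"
      using unprov G(2) by (auto simp: K Box intro: provable.box)
    obtain k where k: "\<And>q. q \<in> names ?K \<longleftrightarrow> q \<in> names G \<or> q = p @ [k]"
      "\<And>q t. tm_in ?K q t \<longleftrightarrow> tm_in G q t"
      "\<And>q \<chi>. fm_in ?K q \<chi> \<longleftrightarrow> fm_in G q \<chi> \<or> (q = p @ [k] \<and> \<chi> = \<phi>)"
      using in_fill_boxed[OF G(2), of "{#\<phi>#}"] by auto
    have red: "reduced ?K (\<lambda>p. {\<chi>. fm_in ?K p \<chi>}) p \<chi>"
      unfolding Box reduced.simps by (intro exI[of _ k]) (simp add: k)
    show ?thesis
      by (rule finish[OF unprov' _ _ _ red]) (use wf G(1) k in \<open>auto simp: Box\<close>)
  qed (use \<chi>(2) in auto)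
qed

lemma achieve_add:
  assumes st: "state C ar K F" and unprov: "\<not> provable C K'"
    and names: "\<And>q. q \<in> names K' \<longleftrightarrow> q \<in> names K"
    and tm: "\<And>q t. tm_in K' q t \<longleftrightarrow> tm_in K q t \<or> (q = p \<and> t \<in># T)"
    and fm: "\<And>q \<chi>. fm_in K' q \<chi> \<longleftrightarrow> fm_in K q \<chi> \<or> (q = p \<and> \<chi> \<in># \<Phi>)"
    and wf: "\<And>\<chi>. \<chi> \<in># \<Phi> \<Longrightarrow> wf_fm ar \<chi>"
  shows "\<exists>K' F'. state C ar K' F' \<and> extends K F K' F' \<and>
    (\<forall>t \<in># T. tm_in K' p t) \<and> (\<forall>\<chi> \<in># \<Phi>. \<chi> \<in> F' p)"
proof -
  have sub: "names K \<subseteq> names K'" using names by auto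
  obtain F' where "state C ar K' F'" "extends K F K' F'" "\<And>p \<chi>. fm_in K' p \<chi> \<Longrightarrow> \<chi> \<in> F' p"
    by (rule state_step[OF st unprov sub]) (use tm fm wf in auto)
  then show ?thesis using tm fm by blast
qed

lemma achieve_add_fm:
  assumes st: "state C ar K F" and "\<not> provable C K'"
    and "\<And>q. q \<in> names K' \<longleftrightarrow> q \<in> names K" "\<And>q t. tm_in K' q t \<longleftrightarrow> tm_in K q t"
    and "\<And>q \<chi>. fm_in K' q \<chi> \<longleftrightarrow> fm_in K q \<chi> \<or> (q = p \<and> \<chi> = \<phi>)"
    and "wf_fm ar \<phi>"
  shows "\<exists>K' F'. state C ar K' F' \<and> extends K F K' F' \<and> \<phi> \<in> F' p"
  using achieve_add[OF assms(1,2,3), of p "{#}" "{#\<phi>#}"] assms by auto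

lemma achieve_add_tm:
  assumes st: "state C ar K F" and "\<not> provable C K'"
    and "\<And>q. q \<in> names K' \<longleftrightarrow> q \<in> names K"
    and "\<And>q s. tm_in K' q s \<longleftrightarrow> tm_in K q s \<or> (q = p \<and> s = t)"
    and "\<And>q \<chi>. fm_in K' q \<chi> \<longleftrightarrow> fm_in K q \<chi>"
  shows "\<exists>K' F'. state C ar K' F' \<and> extends K F K' F' \<and> tm_in K' p t"
  using achieve_add[OF assms(1,2,3), of p "{#t#}" "{#}"] assms by auto

lemma achieve_ref:
  assumes st: "state C ar K F" and p: "p \<in> names K"
  shows "\<exists>K' F'. state C ar K' F' \<and> extends K F K' F' \<and> Neq t t \<in> F' p"
proof (rule achieve_add_fm[OF st])
  show "\<not> provable C (fill p (fmls {#Neq t t#}) K)"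
    using st p by (auto simp: state_def intro: provable.ref)
qed (use p in \<open>auto simp: in_fill\<close>)

text \<open>\<open>M\<close> is a template in which the variable \<open>z\<close> marks the
  occurrences to be rewritten from \<open>t\<close> to \<open>s\<close>.\<close>

lemma achieve_rep:
  assumes st: "state C ar K F"
    and "Neq t s \<in> F p" "subst_var t z M \<in> F p" "Neq t s \<noteq> subst_var t z M" "is_negative_literal M"
  shows "\<exists>K' F'. state C ar K' F' \<and> extends K F K' F' \<and> subst_var s z M \<in> F' p"
proof -
  have "\<not> reducible (subst_var t z M)"
    using assms(5) by (auto simp: is_negative_literal_def subst_var_def)
  then have "fm_in K p (Neq t s)" "fm_in K p (subst_var t z M)"
    using state_fm_in[OF st] assms(2,3) by auto
  then obtain G where K: "K = fill p (fmls {#Neq t s, subst_var t z M#}) G"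
    and G: "names G = names K" "p \<in> names G"
    using assms(4) by (rule ex_context_fm2)
  show ?thesis
  proof (rule achieve_add_fm[OF st])
    show "\<not> provable C (fill p (fmls {#Neq t s, subst_var t z M, subst_var s z M#}) G)"
      using st G(2) assms(5) by (auto simp: state_def K intro: provable.rep)
    have "wf_fm ar (subst_var t z M)"
      using st assms(3) by (auto simp: state_def)
    then show "wf_fm ar (subst_var s z M)" by (simp add: subst_var_def)
  qed (use G(2) in \<open>auto simp: K in_fill\<close>)
qed

lemma achieve_wanted:
  fixes K :: "('p, 'c) nseq"
  assumes st: "state C ar K F" and "wanted C K F g"
  shows "\<exists>K' F'. state C ar K' F' \<and> extends K F K' F' \<and> achieved K' F' g"
proof -
  have unprov: "\<not> provable C K"
    and wf: "\<And>p \<chi>. \<chi> \<in> F p \<Longrightarrow> wf_fm ar \<chi>"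
    and in_names: "\<And>p \<chi>. \<chi> \<in> F p \<Longrightarrow> p \<in> names K"
    using st by (auto simp: state_def)
  show ?thesis
    using assms(2)
  proof cases
    case (reduce \<chi> p)
    then show ?thesis using achieve_reduce[OF st] by simp
  next
    case (ex \<phi> p t)
    have "fm_in K p (Ex \<phi>)" using state_fm_in[OF st ex(2)] by simp
    with ex(3) obtain G where K: "K = fill p (tms_fms {#t#} {#Ex \<phi>#}) G"
      and G: "names G = names K" "p \<in> names G"
      by (rule ex_context_tm_fm)
    have "\<exists>K' F'. state C ar K' F' \<and> extends K F K' F' \<and> inst t \<phi> \<in> F' p"
    proof (rule achieve_add_fm[OF st])
      show "\<not> provable C (fill p (tms_fms {#t#} {#Ex \<phi>, inst t \<phi>#}) G)"
        using unprov G(2) by (auto simp: K intro: provable.ex)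
      show "wf_fm ar (inst t \<phi>)" using wf[OF ex(2)] by simp
    qed (use G(2) in \<open>auto simp: K in_fill\<close>)
    then show ?thesis using ex by simp
  next
    case (dia \<phi> w u)
    have "fm_in K w (Dia \<phi>)" using state_fm_in[OF st dia(2)] by simp
    then obtain G where K: "K = fill w (fmls {#Dia \<phi>#}) G"
      and G: "names G = names K" "w \<in> names G"
      by (rule ex_context_fm)
    have u: "u \<in> names G" using propagates_in_names[OF dia(3)] G(1) by simp
    have pr: "propagates G (lang (SG C) [Fw]) w u"
      using dia(3) G(1) by (intro propagates_mono[of K G]) auto
    have "\<exists>K' F'. state C ar K' F' \<and> extends K F K' F' \<and> \<phi> \<in> F' u"
    proof (rule achieve_add_fm[OF st])
      show "\<not> provable C (fill w (fmls {#Dia \<phi>#}) (fill u (fmls {#\<phi>#}) G))"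
        using unprov G(2) u pr by (auto simp: K intro: provable.dia)
      show "wf_fm ar \<phi>" using wf[OF dia(2)] by simp
    qed (use G(2) u in \<open>auto simp: K in_fill\<close>)
    then show ?thesis using dia by simp
  next
    case (eucl t s p r)
    \<comment> \<open>Rewriting \<open>t\<close> to \<open>s\<close> in \<open>Neq t r\<close>
      yields \<open>Neq s r\<close>. If \<open>s = r\<close>, the two disequalities coincide and may
      be present only once, which is not enough for \<open>rep\<close>; then the goal is an instance
      of reflexivity.\<close>
    show ?thesis
    proof (cases "s = r")
      case True
      then show ?thesis using achieve_ref[OF st in_names[OF eucl(2)]] eucl(1) by simp
    next
      case False
      have "finite (fv_tm r)" by (rule finite_fv_tm)
      then obtain z where z: "z \<notin> fv_tm r" using ex_new_if_finite infinite_UNIV_nat by blast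
      have "subst_var q z (Neq (Var z) r) = (Neq q r :: ('p, 'c) fm)" for q
        using z by (simp add: subst_var_def subst_tm_upd_fresh)
      then show ?thesis
        using achieve_rep[OF st, of t s p z "Neq (Var z) r"] False eucl
        by (simp add: is_negative_literal_def)
    qed
  next
    case (rep ts i s p P)
    have "finite (\<Union>t \<in> set ts. fv_tm t)" by (simp add: finite_fv_tm)
    \<comment> \<open>A fresh \<open>z\<close> placed at position \<open>i\<close> confines the
      rewriting to that position, even if the same term occurs elsewhere in
      \<open>ts\<close>.\<close>
    then obtain z where z: "z \<notin> (\<Union>t \<in> set ts. fv_tm t)"
      using ex_new_if_finite infinite_UNIV_nat by blast
    have "subst_var q z (Neg P (ts[i := Var z])) = Neg P (ts[i := q])" for q
    proof -
      have "map (subst_tm (Var(z := q))) ts = ts"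
        using z by (intro map_idI) (auto simp: subst_tm_upd_fresh)
      then show ?thesis by (simp add: subst_var_def map_update)
    qed
    then show ?thesis
      using achieve_rep[OF st, of "ts ! i" s p z "Neg P (ts[i := Var z])"] rep
      by (simp add: is_negative_literal_def)
  next
    case (rig s t w u)
    show ?thesis
    proof (cases "u = w")
      case True
      then show ?thesis using rig st extends_refl by fastforce
    next
      case False
      have "fm_in K w (Neq s t)" using state_fm_in[OF st rig(2)] by simp
      then obtain G where K: "K = fill w (fmls {#Neq s t#}) G"
        and G: "names G = names K" "w \<in> names G"
        by (rule ex_context_fm)
      have u: "u \<in> names G" using rig(3) G(1) by simp
      have "\<exists>K' F'. state C ar K' F' \<and> extends K F K' F' \<and> Neq s t \<in> F' u"
      proof (rule achieve_add_fm[OF st])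
        show "\<not> provable C (fill w (fmls {#Neq s t#}) (fill u (fmls {#Neq s t#}) G))"
          using unprov G(2) u False using provable.rig[of w G u C s t] by (auto simp: K)
      qed (use G(2) u in \<open>auto simp: K in_fill\<close>)
      then show ?thesis using rig by simp
    qed
  next
    case (dp w t u)
    show ?thesis
    proof (cases "u = w")
      case True
      then show ?thesis using dp st extends_refl by fastforce
    next
      case False
      obtain G where K: "K = fill w (tms {#t#}) G"
        and G: "names G = names K" "w \<in> names G"
        using dp(3) by (rule ex_context_tm)
      have u: "u \<in> names G" using propagates_in_names[OF dp(4)] G(1) by simp
      have pr: "propagates G (dp_lang C) w u"
        using dp(4) G(1) by (intro propagates_mono[of K G]) auto
      have "\<exists>K' F'. state C ar K' F' \<and> extends K F K' F' \<and> tm_in K' u t"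
      proof (rule achieve_add_tm[OF st])
        show "\<not> provable C (fill w (tms {#t#}) (fill u (tms {#t#}) G))"
          using unprov G(2) u pr dp(2) False provable.dp[of C w G u t] by (auto simp: K)
      qed (use G(2) u in \<open>auto simp: K in_fill\<close>)
      then show ?thesis using dp by simp
    qed
  next
    case (d p)
    let ?K = "fill p (boxed (fmls {#})) K"
    have K': "\<not> provable C ?K" using unprov d by (auto intro: provable.d)
    obtain k where k: "\<And>q. q \<in> names ?K \<longleftrightarrow> q \<in> names K \<or> q = p @ [k]"
      "\<And>q t. tm_in ?K q t \<longleftrightarrow> tm_in K q t" "\<And>q \<chi>. fm_in ?K q \<chi> \<longleftrightarrow> fm_in K q \<chi>"
      using in_fill_boxed[OF d(3), of "{#}"] by auto
    have "names K \<subseteq> names ?K" using k by auto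
    then obtain F' where "state C ar ?K F'" "extends K F ?K F'"
      by (rule state_step[OF st K']) (use k in auto)
    then show ?thesis using d k by auto
  next
    case (nd p)
    obtain y where y: "y \<notin> fv_nseq K" using ex_fresh by blast
    have "\<exists>K' F'. state C ar K' F' \<and> extends K F K' F' \<and> tm_in K' p (Var y)"
    proof (rule achieve_add_tm[OF st])
      show "\<not> provable C (fill p (tms {#Var y#}) K)"
        using unprov nd y by (auto intro: provable.nd)
    qed (use nd in \<open>auto simp: in_fill\<close>)
    then show ?thesis using nd by auto
  next
    case (cd p t)
    have "\<exists>K' F'. state C ar K' F' \<and> extends K F K' F' \<and> tm_in K' p t"
    proof (rule achieve_add_tm[OF st])
      show "\<not> provable C (fill p (tms {#t#}) K)"
        using unprov cd by (auto intro: provable.cd)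
    qed (use cd in \<open>auto simp: in_fill\<close>)
    then show ?thesis using cd by simp
  qed (use achieve_ref[OF st, of "[]"] in auto)
qed

text \<open>Only one step ahead has to be bounded. \<open>T\<close> collects the terms of signatures
  and literals, and \<open>\<Psi>\<close> the formulas that a single goal can ask for: present ones,
  instances, bodies of \<open>Dia\<close>, disequalities over \<open>T\<close>, and negated atoms
  with one argument replaced.\<close>

lemma finite_wanted:
  assumes st: "state C ar K F"
  shows "finite {g. wanted C K F g}"
proof -
  define A where "A = names K"
  define \<Phi> where "\<Phi> = (\<Union>p \<in> A. F p)"
  define T where "T = insert (Var 0) ((\<Union>p \<in> A. set_mset (sig_at K p)) \<union> (\<Union>\<chi> \<in> \<Phi>. literal_tms \<chi>))"
  define \<Psi> where "\<Psi> = \<Phi> \<union> (\<lambda>(t, \<phi>). inst t \<phi>) ` (T \<times> Ex -` \<Phi>) \<union> Dia -` \<Phi> \<union> (\<lambda>(t, s). Neq t s) ` (T \<times> T) \<union>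
    (\<Union>(P, ts) \<in> (\<lambda>(P, ts). Neg P ts) -` \<Phi>. (\<lambda>(i, s). Neg P (ts[i := s])) ` ({..<length ts} \<times> T))"
  have fin: "finite A" "finite \<Phi>" "finite T"
    using st by (auto simp: A_def \<Phi>_def T_def state_def finite_names finite_literal_tms)
  then have "finite \<Psi>"
    unfolding \<Psi>_def by (auto intro!: finite_vimageI finite_UN_I injI)
  with fin have "finite ((\<lambda>(p, \<chi>). Reduce p \<chi>) ` (A \<times> \<Phi>) \<union> (\<lambda>(p, \<chi>). AddFm p \<chi>) ` (A \<times> \<Psi>) \<union>
    (\<lambda>(p, t). AddTm p t) ` (A \<times> T) \<union> AddKid ` A \<union> AddSome ` A)" (is "finite ?B")
    by blast
  have "g \<in> ?B" if "wanted C K F g" for g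
  proof -
    have F: "p \<in> A \<and> \<chi> \<in> \<Phi>" if "\<chi> \<in> F p" for p \<chi>
      using that st by (auto simp: state_def A_def \<Phi>_def)
    have S: "p \<in> A \<and> t \<in> T" if "tm_in K p t" for p t
      using that by (auto simp: tm_in_def A_def T_def)
    have lit: "t \<in> T" if "\<chi> \<in> F p" "t \<in> literal_tms \<chi>" for \<chi> p t
      using F[OF that(1)] that(2) by (auto simp: T_def)
    have root: "[] \<in> A" "Var 0 \<in> T" by (auto simp: A_def T_def)
    have fm: "AddFm p \<chi> \<in> ?B" if "p \<in> A" "\<chi> \<in> \<Psi>" for p \<chi>
      using that by auto
    have neq: "Neq t s \<in> \<Psi>" if "t \<in> T" "s \<in> T" for t s
      using that by (auto simp: \<Psi>_def)
    show ?thesis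
      using that
    proof cases
      case (reduce \<chi> p)
      then show ?thesis using F by auto
    next
      case (ex \<phi> p t)
      then have "inst t \<phi> \<in> \<Psi>" using F S by (force simp: \<Psi>_def)
      then show ?thesis using ex F fm by auto
    next
      case (dia \<phi> w u)
      then have "\<phi> \<in> \<Psi>" using F by (auto simp: \<Psi>_def)
      moreover have "u \<in> A" using propagates_in_names[OF dia(3)] by (simp add: A_def)
      ultimately show ?thesis using dia fm by auto
    next
      case (ref_lit \<chi> p t)
      then show ?thesis using lit neq fm root by metis
    next
      case (ref_sig p t)
      then show ?thesis using S neq fm root by metis
    next
      case ref_var
      then show ?thesis using neq fm root by metis
    next
      case (eucl t s p r)
      then have "s \<in> T" "r \<in> T" using lit[of "Neq t s" p s] lit[of "Neq t r" p r] by auto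
      then show ?thesis using eucl neq fm F by metis
    next
      case (rep ts i s p P)
      then have "s \<in> T" "Neg P ts \<in> \<Phi>" using lit[of _ p s] F by auto
      then have "Neg P (ts[i := s]) \<in> \<Psi>" using rep(4) by (force simp: \<Psi>_def)
      then show ?thesis using rep fm F by metis
    next
      case (rig s t w u)
      then have "Neq s t \<in> \<Psi>" "u \<in> A" using F by (auto simp: \<Psi>_def A_def)
      then show ?thesis using rig fm by auto
    next
      case (dp w t u)
      moreover have "u \<in> A" using propagates_in_names[OF dp(4)] by (simp add: A_def)
      ultimately show ?thesis using S by auto
    next
      case (cd p t)
      then have "t \<in> T" using lit[of "Neq t t" "[]" t] by auto
      then show ?thesis using cd by (auto simp: A_def)
    qed (auto simp: A_def)
  qed
  then have "{g. wanted C K F g} \<subseteq> ?B" by blast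
  then show ?thesis using \<open>finite ?B\<close> by (rule finite_subset)
qed

section \<open>Fair chains of refutation states\<close>

lemma achieve_finitely_many:
  assumes "finite A" "state C ar K F" "\<And>g. g \<in> A \<Longrightarrow> wanted C K F g"
  shows "\<exists>K' F'. state C ar K' F' \<and> extends K F K' F' \<and> (\<forall>g \<in> A. achieved K' F' g)"
  using assms
proof (induction A)
  case empty
  then show ?case using extends_refl by blast
next
  case (insert g A)
  then obtain K' F' where 1: "state C ar K' F'" "extends K F K' F'" "\<forall>g \<in> A. achieved K' F' g"
    by auto
  then obtain K'' F'' where "state C ar K'' F''" "extends K' F' K'' F''" "achieved K'' F'' g"
    using achieve_wanted[OF 1(1)] wanted_mono[OF 1(2)] insert.prems by blast
  then show ?case using 1 extends_trans achieved_mono by (metis insert_iff)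
qed

lemma ex_fair_chain:
  assumes "state C ar K\<^sub>0 F\<^sub>0"
  obtains K F where "K 0 = K\<^sub>0" "F 0 = F\<^sub>0" "\<And>n. state C ar (K n) (F n)"
    "\<And>n. extends (K n) (F n) (K (Suc n)) (F (Suc n))"
    "\<And>n g. wanted C (K n) (F n) g \<Longrightarrow> achieved (K (Suc n)) (F (Suc n)) g"
proof -
  have "\<exists>X. \<forall>n. (state C ar (fst (X n)) (snd (X n)) \<and> (n = 0 \<longrightarrow> X n = (K\<^sub>0, F\<^sub>0))) \<and>
    (extends (fst (X n)) (snd (X n)) (fst (X (Suc n))) (snd (X (Suc n))) \<and>
     (\<forall>g. wanted C (fst (X n)) (snd (X n)) g \<longrightarrow> achieved (fst (X (Suc n))) (snd (X (Suc n))) g))"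
  proof (rule dependent_nat_choice)
    show "\<exists>x. state C ar (fst x) (snd x) \<and> ((0::nat) = 0 \<longrightarrow> x = (K\<^sub>0, F\<^sub>0))"
      using assms by auto
  next
    fix x and n :: nat
    assume "state C ar (fst x) (snd x) \<and> (n = 0 \<longrightarrow> x = (K\<^sub>0, F\<^sub>0))"
    then obtain K' F' where "state C ar K' F'" "extends (fst x) (snd x) K' F'"
      "\<forall>g. wanted C (fst x) (snd x) g \<longrightarrow> achieved K' F' g"
      using achieve_finitely_many[OF finite_wanted[of C ar "fst x" "snd x"], of C ar "fst x" "snd x"]
      by blast
    then show "\<exists>y. (state C ar (fst y) (snd y) \<and> (Suc n = 0 \<longrightarrow> y = (K\<^sub>0, F\<^sub>0))) \<and>
      extends (fst x) (snd x) (fst y) (snd y) \<and>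
      (\<forall>g. wanted C (fst x) (snd x) g \<longrightarrow> achieved (fst y) (snd y) g)"
      by (intro exI[of _ "(K', F')"]) auto
  qed
  then obtain X where X: "\<And>n. (state C ar (fst (X n)) (snd (X n)) \<and> (n = 0 \<longrightarrow> X n = (K\<^sub>0, F\<^sub>0))) \<and>
    (extends (fst (X n)) (snd (X n)) (fst (X (Suc n))) (snd (X (Suc n))) \<and>
     (\<forall>g. wanted C (fst (X n)) (snd (X n)) g \<longrightarrow> achieved (fst (X (Suc n))) (snd (X (Suc n))) g))"
    by blast
  show thesis
    by (rule that[of "\<lambda>n. fst (X n)" "\<lambda>n. snd (X n)"]) (use X in auto)
qed


subsection \<open>Propagation languages\<close>

lemma derives_context:
  assumes "(s, t) \<in> (derives1 S)\<^sup>*"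
  shows "(l @ s @ r, l @ t @ r) \<in> (derives1 S)\<^sup>*"
  using assms
proof induction
  case (step t u)
  then obtain l' r' c v where "t = l' @ [c] @ r'" "u = l' @ v @ r'" "(c, v) \<in> S"
    by (auto simp: derives1_def)
  then have "l @ t @ r = (l @ l') @ [c] @ (r' @ r)" "l @ u @ r = (l @ l') @ v @ (r' @ r)" "(c, v) \<in> S"
    by simp_all
  then have "(l @ t @ r, l @ u @ r) \<in> derives1 S"
    unfolding derives1_def by blast
  then show ?case using step.IH by (rule rtrancl_into_rtrancl[rotated])
qed simp

lemma lang_refl: "s \<in> lang S s"
  by (simp add: lang_def)

lemma lang_trans: "u \<in> lang S t \<Longrightarrow> t \<in> lang S s \<Longrightarrow> u \<in> lang S s"
  by (auto simp: lang_def)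

lemma lang_append: "t \<in> lang S s \<Longrightarrow> t' \<in> lang S s' \<Longrightarrow> t @ t' \<in> lang S (s @ s')"
  using derives_context[of s t S "[]" s'] derives_context[of s' t' S t "[]"]
  by (auto simp: lang_def)

lemma lang_production:
  assumes "(c, s) \<in> S"
  shows "s \<in> lang S [c]"
proof -
  have "([] @ [c] @ [], [] @ s @ []) \<in> derives1 S"
    using assms unfolding derives1_def by blast
  then show ?thesis by (auto simp: lang_def)
qed

lemma lang_mono: "S \<subseteq> S' \<Longrightarrow> lang S s \<subseteq> lang S' s"
proof -
  assume "S \<subseteq> S'"
  then have "derives1 S \<subseteq> derives1 S'" unfolding derives1_def by blast
  then have "(derives1 S)\<^sup>* \<subseteq> (derives1 S')\<^sup>*" by (rule rtrancl_mono)
  then show "lang S s \<subseteq> lang S' s" by (auto simp: lang_def)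
qed

text \<open>For both directions \<open>c\<close>, \<open>[Fw]\<close> derives
  \<open>[c, Fw]\<close>, whose last letter then derives the rest of the word. So with both
  \<open>CondID\<close> and \<open>CondDD\<close>, terms propagate along every path.\<close>

lemma lang_S5: "s \<in> lang S5 [Fw]"
proof (induction s)
  case Nil
  show ?case by (rule lang_production) (simp add: S5_def)
next
  case (Cons c s)
  have bf: "[Bw, Fw] \<in> lang S5 [Fw]" and bbf: "[Bw, Fw] \<in> lang S5 [Bw]" and e: "[] \<in> lang S5 [Bw]"
    by (rule lang_production, simp add: S5_def)+
  \<comment> \<open>The derivation is f \<rightarrow> bf \<rightarrow> bff \<rightarrow> ff; the
    last step erases b.\<close>
  have "[Fw, Fw] \<in> lang S5 [Fw]"
  proof (rule lang_trans[OF _ bf])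
    have "[Bw, Fw, Fw] \<in> lang S5 [Bw, Fw]" using lang_append[OF bbf lang_refl[of "[Fw]"]] by simp
    moreover have "[Fw, Fw] \<in> lang S5 [Bw, Fw, Fw]" using lang_append[OF e lang_refl[of "[Fw, Fw]"]] by simp
    ultimately show "[Fw, Fw] \<in> lang S5 [Bw, Fw]" by (rule lang_trans[rotated])
  qed
  with bf have "[c, Fw] \<in> lang S5 [Fw]" by (cases c) auto
  moreover have "c # s \<in> lang S5 [c, Fw]" using lang_append[OF lang_refl[of "[c]"] Cons] by simp
  ultimately show ?case by (rule lang_trans[rotated])
qed

primrec flip :: "dir \<Rightarrow> dir" where
  "flip Fw = Bw"
| "flip Bw = Fw"

definition converse_word :: "dir list \<Rightarrow> dir list" where
  "converse_word s = rev (map flip s)"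

text \<open>The converse of \<open>b^n f^k\<close> is \<open>b^k f^n\<close>, the right-hand side of
  the other production contributed by the same \<open>CondG n k\<close>.\<close>

lemma SG_converse: "(c, s) \<in> SG C \<Longrightarrow> (flip c, converse_word s) \<in> SG C"
  unfolding SG_def converse_word_def by (cases c) (fastforce simp: rev_map[symmetric])+

lemma lang_converse:
  assumes "t \<in> lang (SG C) s"
  shows "converse_word t \<in> lang (SG C) (converse_word s)"
proof -
  have "(s, t) \<in> (derives1 (SG C))\<^sup>*" using assms by (simp add: lang_def)
  then have "(converse_word s, converse_word t) \<in> (derives1 (SG C))\<^sup>*"
  proof induction
    case (step t u)
    then obtain l r c v where tu: "t = l @ [c] @ r" "u = l @ v @ r" "(c, v) \<in> SG C"
      by (auto simp: derives1_def)
    then have "converse_word t = converse_word r @ [flip c] @ converse_word l"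
      "converse_word u = converse_word r @ converse_word v @ converse_word l"
      by (simp_all add: converse_word_def)
    then have "(converse_word t, converse_word u) \<in> derives1 (SG C)"
      unfolding derives1_def using SG_converse[OF tu(3)] by blast
    with step.IH show ?case by (rule rtrancl_into_rtrancl)
  qed simp
  then show ?thesis by (simp add: lang_def)
qed

section \<open>Paths in possibly infinite trees\<close>

text \<open>The limit tree can be infinite and is then no nested sequent, so propagation is restated
  for a bare set of names.\<close>

definition move_on :: "name set \<Rightarrow> dir \<Rightarrow> name \<Rightarrow> name \<Rightarrow> bool" where
  "move_on N c w u \<longleftrightarrow> w \<in> N \<and> u \<in> N \<and>
     (case c of Fw \<Rightarrow> \<exists>i. u = w @ [i] | Bw \<Rightarrow> \<exists>i. w = u @ [i])"

primrec path_on :: "name set \<Rightarrow> dir list \<Rightarrow> name \<Rightarrow> name \<Rightarrow> bool" where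
  "path_on N [] w u \<longleftrightarrow> w \<in> N \<and> w = u"
| "path_on N (c # s) w u \<longleftrightarrow> (\<exists>v. move_on N c w v \<and> path_on N s v u)"

lemma path_on_names: "path_on (names K) s w u \<longleftrightarrow> path K s w u"
proof (induction s arbitrary: w)
  case (Cons c s)
  have "move_on (names K) c w v \<longleftrightarrow> move K c w v" for v
    by (cases c) (auto simp: move_on_def is_child_def)
  then show ?case using Cons by simp
qed simp

lemma path_on_in: "path_on N s w u \<Longrightarrow> w \<in> N \<and> u \<in> N"
  by (induction s arbitrary: w) (auto simp: move_on_def)

lemma path_on_append: "path_on N s w v \<Longrightarrow> path_on N s' v u \<Longrightarrow> path_on N (s @ s') w u"
  by (induction s arbitrary: w) auto

lemma path_on_converse: "path_on N s w u \<Longrightarrow> path_on N (converse_word s) u w"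
proof (induction s arbitrary: w)
  case (Cons c s)
  then obtain v where v: "move_on N c w v" "path_on N s v u" by auto
  have "path_on N [flip c] v w" using v(1) by (cases c) (auto simp: move_on_def)
  then show ?case
    using path_on_append[OF Cons.IH[OF v(2)]] by (simp add: converse_word_def)
qed (simp add: converse_word_def)

text \<open>A path visits finitely many components, all of which are present from some stage
  on.\<close>

lemma path_on_Union:
  assumes "\<And>n. A n \<subseteq> A (Suc n)" "path_on (\<Union>n. A n) s w u"
  shows "\<forall>\<^sub>F n in sequentially. path_on (A n) s w u"
proof -
  have mono: "m \<le> n \<Longrightarrow> A m \<subseteq> A n" for m n :: nat
    using assms(1) by (rule lift_Suc_mono_le)
  have ev: "\<forall>\<^sub>F n in sequentially. x \<in> A n" if "x \<in> (\<Union>n. A n)" for x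
    using that mono unfolding eventually_sequentially by blast
  show ?thesis
    using assms(2)
  proof (induction s arbitrary: w)
    case Nil
    then show ?case using ev[of w] by auto
  next
    case (Cons c s)
    then obtain v where v: "move_on (\<Union>n. A n) c w v" "path_on (\<Union>n. A n) s v u" by auto
    then have "w \<in> (\<Union>n. A n)" "v \<in> (\<Union>n. A n)" by (auto simp: move_on_def)
    from ev[OF this(1)] ev[OF this(2)] Cons.IH[OF v(2)] show ?case
    proof eventually_elim
      case (elim n)
      then show ?case using v(1) by (auto simp: move_on_def)
    qed
  qed
qed

subsection \<open>The canonical model of a saturated tree\<close>

text \<open>These are the goals of \<open>wanted\<close> read in the limit, plus consistency on
  literals. Countability is asked of the root only, because that is where disequalities are
  read.\<close>

locale hintikka =
  fixes C :: "cond set"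
    and ar :: "'p \<Rightarrow> nat"
    and N :: "name set"
    and S :: "name \<Rightarrow> 'c tm set"
    and F :: "name \<Rightarrow> ('p, 'c) fm set"
  assumes root: "[] \<in> N"
    and F_in: "\<chi> \<in> F p \<Longrightarrow> p \<in> N \<and> wf_fm ar \<chi>"
    and countable_F: "countable (F [])"
    and consistent: "is_literal L \<Longrightarrow> L \<in> F p \<Longrightarrow> neg L \<notin> F p"
    and disj: "Or \<phi> \<psi> \<in> F p \<Longrightarrow> \<phi> \<in> F p \<and> \<psi> \<in> F p"
    and conj: "And \<phi> \<psi> \<in> F p \<Longrightarrow> \<phi> \<in> F p \<or> \<psi> \<in> F p"
    and all: "All \<phi> \<in> F p \<Longrightarrow> \<exists>y. Var y \<in> S p \<and> inst (Var y) \<phi> \<in> F p"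
    and box: "Box \<phi> \<in> F p \<Longrightarrow> \<exists>i. p @ [i] \<in> N \<and> \<phi> \<in> F (p @ [i])"
    and ex: "Ex \<phi> \<in> F p \<Longrightarrow> t \<in> S p \<Longrightarrow> inst t \<phi> \<in> F p"
    and dia: "Dia \<phi> \<in> F w \<Longrightarrow> str \<in> lang (SG C) [Fw] \<Longrightarrow> path_on N str w u \<Longrightarrow> \<phi> \<in> F u"
    and ref_lit: "\<chi> \<in> F p \<Longrightarrow> t \<in> literal_tms \<chi> \<Longrightarrow> Neq t t \<in> F []"
    and ref_sig: "t \<in> S p \<Longrightarrow> Neq t t \<in> F []"
    and ref_var: "Neq (Var 0) (Var 0) \<in> F []"
    and eucl: "Neq t s \<in> F p \<Longrightarrow> Neq t r \<in> F p \<Longrightarrow> Neq s r \<in> F p"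
    and rep: "Neq (ts ! i) s \<in> F p \<Longrightarrow> Neg P ts \<in> F p \<Longrightarrow> i < length ts \<Longrightarrow> Neg P (ts[i := s]) \<in> F p"
    and rig: "Neq s t \<in> F w \<Longrightarrow> u \<in> N \<Longrightarrow> Neq s t \<in> F u"
    and dp: "CondID \<in> C \<or> CondDD \<in> C \<Longrightarrow> t \<in> S w \<Longrightarrow> str \<in> dp_lang C \<Longrightarrow> path_on N str w u \<Longrightarrow> t \<in> S u"
    and d: "CondD \<in> C \<Longrightarrow> p \<in> N \<Longrightarrow> \<exists>i. p @ [i] \<in> N"
    and nd: "CondNE \<in> C \<Longrightarrow> p \<in> N \<Longrightarrow> S p \<noteq> {}"
    and cd: "CondCD \<in> C \<Longrightarrow> p \<in> N \<Longrightarrow> Neq t t \<in> F [] \<Longrightarrow> t \<in> S p"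
begin

text \<open>\<open>Neq t t\<close> at the root certifies that \<open>t\<close> takes part in the
  equality reasoning. By \<open>ref_lit\<close> and \<open>ref_sig\<close> this covers the terms of
  literals and signatures in all components.\<close>

definition T :: "'c tm set" where
  "T = {t. Neq t t \<in> F []}"

definition R :: "(name \<times> name) set" where
  "R = {(w, u). \<exists>s \<in> lang (SG C) [Fw]. path_on N s w u}"

lemma neq_sym: "t \<in> T \<Longrightarrow> Neq t s \<in> F [] \<Longrightarrow> Neq s t \<in> F []"
  unfolding T_def using eucl by blast

text \<open>Since \<open>t \<noteq> s\<close> being in a refuted sequent means that \<open>t\<close> and \<open>s\<close> are to be equal, the
  disequalities form an equivalence relation on \<open>T\<close>, whose quotient is countable.\<close>

lemma ex_valuation:
  assumes "infinite (UNIV :: 'u set)"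
  obtains \<nu> :: "'c tm \<Rightarrow> 'u" where
    "\<And>t s. t \<in> T \<Longrightarrow> s \<in> T \<Longrightarrow> \<nu> t = \<nu> s \<longleftrightarrow> Neq t s \<in> F []" "range \<nu> = \<nu> ` T"
proof -
  obtain f :: "nat \<Rightarrow> 'u" where f: "inj f"
    using infinite_countable_subset[OF assms] by blast
  define cls where "cls t = {s. Neq t s \<in> F []}" for t
  \<comment> \<open>Terms outside \<open>T\<close> get the value of \<open>Var 0\<close>, which lies
    in \<open>T\<close>. Hence every variable and constant denotes an object of the outer
    domain.\<close>
  define \<nu> where
    "\<nu> t = f (to_nat_on (cls ` T) (cls (if t \<in> T then t else Var 0)))" for t
  have "countable ((\<lambda>t. Neq t t :: ('p, 'c) fm) ` T)"
    by (rule countable_subset[OF _ countable_F]) (auto simp: T_def)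
  then have "countable T"
    by (rule countable_image_inj_on) (auto intro: inj_onI)
  then have inj: "inj_on (to_nat_on (cls ` T)) (cls ` T)"
    by (intro inj_on_to_nat_on countable_image)
  have "cls t = cls s \<longleftrightarrow> Neq t s \<in> F []" if "t \<in> T" "s \<in> T" for t s
  proof
    assume "cls t = cls s"
    then show "Neq t s \<in> F []" using that by (auto simp: cls_def T_def)
  next
    assume "Neq t s \<in> F []"
    with neq_sym[OF that(1) this] have "Neq t r \<in> F [] \<longleftrightarrow> Neq s r \<in> F []" for r
      using eucl[of t s "[]" r] eucl[of s t "[]" r] by blast
    then show "cls t = cls s" by (simp add: cls_def)
  qed
  then have "\<nu> t = \<nu> s \<longleftrightarrow> Neq t s \<in> F []" if "t \<in> T" "s \<in> T" for t s
    using that inj_eq[OF f] inj_on_eq_iff[OF inj, of "cls t" "cls s"] by (simp add: \<nu>_def)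
  moreover have "\<nu> t \<in> \<nu> ` T" for t
  proof (cases "t \<in> T")
    case False
    then have "\<nu> t = \<nu> (Var 0)" "Var 0 \<in> T" using ref_var by (simp_all add: \<nu>_def T_def)
    then show ?thesis by blast
  qed simp
  ultimately show thesis using that by blast
qed

text \<open>\<open>rep\<close> changes one argument at a time; \<open>rs\<close> is the prefix
  already rewritten.\<close>

lemma Neg_replace_all:
  assumes "list_all2 (\<lambda>t s. Neq t s \<in> F p) ts us" "Neg P (rs @ ts) \<in> F p"
  shows "Neg P (rs @ us) \<in> F p"
  using assms
proof (induction arbitrary: rs)
  case (Cons t ts u us)
  have "Neg P ((rs @ t # ts)[length rs := u]) \<in> F p"
    using Cons by (intro rep) auto
  then show ?case using Cons.IH[of "rs @ [u]"] by simp
qed simp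

section \<open>Frame conditions of the canonical model\<close>

lemma relpow_R_path: "(w, u) \<in> R ^^ n \<Longrightarrow> w \<in> N \<Longrightarrow> \<exists>s \<in> lang (SG C) (replicate n Fw). path_on N s w u"
proof (induction n arbitrary: u)
  \<comment> \<open>\<open>R ^^ 0\<close> relates every name to itself, whereas the empty path
    exists only at members of \<open>N\<close>.\<close>
  case 0
  then show ?case by (auto intro!: bexI[of _ "[]"] lang_refl)
next
  case (Suc n)
  then obtain v where "(w, v) \<in> R ^^ n" "(v, u) \<in> R" by auto
  moreover from this Suc obtain s where "s \<in> lang (SG C) (replicate n Fw)" "path_on N s w v"
    by blast
  moreover obtain s' where "s' \<in> lang (SG C) [Fw]" "path_on N s' v u"
    using \<open>(v, u) \<in> R\<close> by (auto simp: R_def)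
  ultimately have "s @ s' \<in> lang (SG C) (replicate (Suc n) Fw)" "path_on N (s @ s') w u"
    using lang_append[of s "SG C" "replicate n Fw" s' "[Fw]"] path_on_append
    by (auto simp: replicate_append_same)
  then show ?case by blast
qed

lemma R_G:
  assumes "CondG n k \<in> C" "w \<in> N" "(w, u) \<in> R ^^ n" "(w, v) \<in> R ^^ k"
  shows "(u, v) \<in> R"
proof -
  obtain s s' where s: "s \<in> lang (SG C) (replicate n Fw)" "path_on N s w u"
    and s': "s' \<in> lang (SG C) (replicate k Fw)" "path_on N s' w v"
    using relpow_R_path assms by meson
  have "converse_word (replicate n Fw) = replicate n Bw" by (simp add: converse_word_def)
  then have "converse_word s @ s' \<in> lang (SG C) (replicate n Bw @ replicate k Fw)"
    using lang_append[OF lang_converse[OF s(1)] s'(1)] by simp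
  moreover have "replicate n Bw @ replicate k Fw \<in> lang (SG C) [Fw]"
    using assms(1) by (intro lang_production) (auto simp: SG_def)
  ultimately have "converse_word s @ s' \<in> lang (SG C) [Fw]" by (rule lang_trans)
  moreover have "path_on N (converse_word s @ s') u v"
    using path_on_append path_on_converse s(2) s'(2) by blast
  ultimately show ?thesis by (auto simp: R_def)
qed

lemma R_in: "(w, u) \<in> R \<Longrightarrow> w \<in> N \<and> u \<in> N"
  by (auto simp: R_def dest: path_on_in)

lemma R_child: "w \<in> N \<Longrightarrow> w @ [i] \<in> N \<Longrightarrow> (w, w @ [i]) \<in> R"
  by (auto simp: R_def move_on_def intro!: bexI[of _ "[Fw]"] lang_refl)

text \<open>With \<open>CondID\<close> alone, the grammar of \<open>dp\<close> extends S(G) and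
  starts from f as well, so terms travel along whole \<open>R\<close>-words and not just along
  edges; with \<open>CondDD\<close> in addition, every word is allowed.\<close>

lemma R_ID:
  assumes "CondID \<in> C" "(w, v) \<in> R"
  shows "S w \<subseteq> S v"
proof -
  obtain s where s: "s \<in> lang (SG C) [Fw]" "path_on N s w v" using assms by (auto simp: R_def)
  have "s \<in> dp_lang C"
    using assms(1) lang_S5[of s] lang_mono[of "SG C" "S4 \<union> SG C" "[Fw]"] s(1) by (auto simp: dp_lang_def)
  then show ?thesis using dp s(2) assms(1) by blast
qed

text \<open>Terms have to travel from \<open>v\<close> back to \<open>w\<close>. The converse of the
  \<open>R\<close>-word does this, and it is derived from b, the start symbol of \<open>dp\<close>
  for \<open>CondDD\<close> alone.\<close>

lemma R_DD:
  assumes "CondDD \<in> C" "(w, v) \<in> R"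
  shows "S v \<subseteq> S w"
proof -
  obtain s where s: "s \<in> lang (SG C) [Fw]" "path_on N s w v" using assms by (auto simp: R_def)
  have "converse_word s \<in> lang (SG C) [Bw]"
    using lang_converse[OF s(1)] by (simp add: converse_word_def)
  then have "converse_word s \<in> dp_lang C"
    using assms(1) lang_S5 lang_mono[of "SG C" "S4 \<union> SG C" "[Bw]"] by (auto simp: dp_lang_def)
  then show ?thesis using dp path_on_converse[OF s(2)] assms(1) by blast
qed

text \<open>Only those atoms are true that some negated atom of the component forces, up to equality
  of values. Components are carried into the world type by \<open>f\<close>, so \<open>inv f\<close>
  recovers the component of a world.\<close>

definition canonical :: "(name \<Rightarrow> 'w) \<Rightarrow> ('c tm \<Rightarrow> 'u) \<Rightarrow> ('w, 'u, 'p, 'c) model" where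
  "canonical f \<nu> = \<lparr>worlds = f ` N, acc = map_prod f f ` R, outer = \<nu> ` T,
     inner = (\<lambda>x. \<nu> ` S (inv f x)),
     pred_int = (\<lambda>x P. {map \<nu> ts | ts. Neg P ts \<in> F (inv f x)}),
     const_int = (\<lambda>x a. \<nu> (Cst a))\<rparr>"

lemma tm_val_canonical [simp]: "tm_val (canonical f \<nu>) x (\<lambda>n. \<nu> (Var n)) t = \<nu> t"
  by (cases t) (auto simp: canonical_def)

text \<open>Here the goal for \<open>Var 0\<close> pays off: it makes the outer domain nonempty even
  if no term occurs in the tree. By \<open>ref_sig\<close>, inner domains lie in the outer
  one.\<close>

lemma is_frame_canonical: "inj f \<Longrightarrow> is_frame (canonical f \<nu>)"
  using root ref_var ref_sig R_in by (fastforce simp: is_frame_def canonical_def T_def)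

lemma is_model_canonical: "inj f \<Longrightarrow> range \<nu> = \<nu> ` T \<Longrightarrow> is_model ar (canonical f \<nu>)"
  using is_frame_canonical[of f \<nu>] F_in by (fastforce simp: is_model_def canonical_def)

lemma relpow_image:
  assumes "inj f" "(f w, y) \<in> (map_prod f f ` R) ^^ n"
  shows "\<exists>u. y = f u \<and> (w, u) \<in> R ^^ n"
  using assms(2)
proof (induction n arbitrary: y)
  case (Suc n)
  then obtain x where x: "(f w, x) \<in> (map_prod f f ` R) ^^ n" "(x, y) \<in> map_prod f f ` R" by auto
  then obtain u where "x = f u" "(w, u) \<in> R ^^ n" using Suc.IH by blast
  with x(2) show ?case using inj_eq[OF assms(1)] by auto
qed simp

lemma in_class_canonical:
  assumes "inj f"
  shows "in_class C (canonical f \<nu>)"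
proof -
  have "cond_holds (canonical f \<nu>) c" if "c \<in> C" for c
  proof (cases c)
    case CondD
    then show ?thesis using that d R_child by (fastforce simp: canonical_def)
  next
    case (CondG n k)
    have "(x, y) \<in> map_prod f f ` R" if "w \<in> N" "(f w, x) \<in> (map_prod f f ` R) ^^ n"
      "(f w, y) \<in> (map_prod f f ` R) ^^ k" for w x y
      using relpow_image[OF assms that(2)] relpow_image[OF assms that(3)] R_G[OF _ that(1)] CondG \<open>c \<in> C\<close>
      by auto
    then show ?thesis using CondG by (auto simp: canonical_def)
  next
    case CondID
    then show ?thesis using that R_ID assms by (fastforce simp: canonical_def)
  next
    case CondDD
    then show ?thesis using that R_DD assms by (fastforce simp: canonical_def)
  next
    case CondCD
    have "S p = T" if "p \<in> N" for p
      using cd[OF _ that] ref_sig CondCD \<open>c \<in> C\<close> by (auto simp: T_def)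
    then show ?thesis using CondCD assms by (auto simp: canonical_def)
  next
    case CondNE
    then show ?thesis using that nd assms by (auto simp: canonical_def)
  qed
  then show ?thesis using is_frame_canonical[OF assms] by (simp add: in_class_def)
qed

end

section \<open>Substitution and satisfaction\<close>

text \<open>Induction measure for the truth lemma: an instance of a quantified formula is not a
  subformula, but substitution keeps the depth.\<close>

primrec depth :: "('p, 'c) fm \<Rightarrow> nat" where
  "depth (Pos P ts) = 0"
| "depth (Neg P ts) = 0"
| "depth (Eq t s) = 0"
| "depth (Neq t s) = 0"
| "depth (Or \<phi> \<psi>) = Suc (max (depth \<phi>) (depth \<psi>))"
| "depth (And \<phi> \<psi>) = Suc (max (depth \<phi>) (depth \<psi>))"
| "depth (Ex \<phi>) = Suc (depth \<phi>)"
| "depth (All \<phi>) = Suc (depth \<phi>)"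
| "depth (Dia \<phi>) = Suc (depth \<phi>)"
| "depth (Box \<phi>) = Suc (depth \<phi>)"

lemma depth_subst: "depth (subst \<theta> \<phi>) = depth \<phi>"
  by (induction \<phi> arbitrary: \<theta>) auto

lemma tm_val_under_binder:
  "(\<lambda>x. tm_val M w (case_nat d \<sigma>) (under_binder \<theta> x)) = case_nat d (\<lambda>x. tm_val M w \<sigma> (\<theta> x))"
proof
  fix x
  have shift: "tm_val M w (case_nat d \<sigma>) (shift_tm t) = tm_val M w \<sigma> t" for t
    by (cases t) auto
  show "tm_val M w (case_nat d \<sigma>) (under_binder \<theta> x) = case_nat d (\<lambda>x. tm_val M w \<sigma> (\<theta> x)) x"
    by (cases x) (auto simp: under_binder_def shift)
qed

text \<open>Rigidity is what lets a substitution pass below \<open>Dia\<close> and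
  \<open>Box\<close>: the substituted terms are evaluated at \<open>w\<close>, while the body is
  evaluated at an accessible world.\<close>

lemma sat_subst:
  assumes rigid: "\<And>w u a. const_int M w a = const_int M u a"
  shows "sat M w \<sigma> (subst \<theta> \<phi>) \<longleftrightarrow> sat M w (\<lambda>x. tm_val M w \<sigma> (\<theta> x)) \<phi>"
proof (induction \<phi> arbitrary: w \<sigma> \<theta>)
  case (Dia \<phi>)
  have "tm_val M u \<sigma> t = tm_val M w \<sigma> t" for u t using rigid by (cases t) auto
  then have "(\<lambda>x. tm_val M u \<sigma> (\<theta> x)) = (\<lambda>x. tm_val M w \<sigma> (\<theta> x))" for u by blast
  then show ?case unfolding subst.simps sat.simps Dia.IH by metis
next
  case (Box \<phi>)
  have "tm_val M u \<sigma> t = tm_val M w \<sigma> t" for u t using rigid by (cases t) auto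
  then have "(\<lambda>x. tm_val M u \<sigma> (\<theta> x)) = (\<lambda>x. tm_val M w \<sigma> (\<theta> x))" for u by blast
  then show ?case unfolding subst.simps sat.simps Box.IH by metis
next
  case (Ex \<phi>)
  then show ?case by (simp add: tm_val_under_binder)
next
  case (All \<phi>)
  then show ?case by (simp add: tm_val_under_binder)
next
  case (Pos P ts)
  have "tm_val M w \<sigma> (subst_tm \<theta> t) = tm_val M w (\<lambda>x. tm_val M w \<sigma> (\<theta> x)) t" for t
    by (cases t) auto
  then show ?case by (simp add: comp_def)
next
  case (Neg P ts)
  have "tm_val M w \<sigma> (subst_tm \<theta> t) = tm_val M w (\<lambda>x. tm_val M w \<sigma> (\<theta> x)) t" for t
    by (cases t) auto
  then show ?case by (simp add: comp_def)
next
  case (Eq t s)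
  have "tm_val M w \<sigma> (subst_tm \<theta> t) = tm_val M w (\<lambda>x. tm_val M w \<sigma> (\<theta> x)) t" for t
    by (cases t) auto
  then show ?case by simp
next
  case (Neq t s)
  have "tm_val M w \<sigma> (subst_tm \<theta> t) = tm_val M w (\<lambda>x. tm_val M w \<sigma> (\<theta> x)) t" for t
    by (cases t) auto
  then show ?case by simp
qed auto

lemma sat_inst:
  assumes "\<And>w u a. const_int M w a = const_int M u a"
  shows "sat M w \<sigma> (inst t \<phi>) \<longleftrightarrow> sat M w (case_nat (tm_val M w \<sigma> t) \<sigma>) \<phi>"
proof -
  have "(\<lambda>x. tm_val M w \<sigma> (case_nat t Var x)) = case_nat (tm_val M w \<sigma> t) \<sigma>"
    by (auto split: nat.splits)
  then show ?thesis using sat_subst[OF assms] by (simp add: inst_def)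
qed

context hintikka
begin

text \<open>The truth lemma. Negative literals fail by the choice of \<open>\<nu>\<close> and of the
  predicate interpretation; positive ones fail because their truth would place their negation in the
  same component, against consistency.\<close>

lemma canonical_falsifies:
  assumes f: "inj f"
    and \<nu>: "\<And>t s. t \<in> T \<Longrightarrow> s \<in> T \<Longrightarrow> \<nu> t = \<nu> s \<longleftrightarrow> Neq t s \<in> F []"
  shows "\<phi> \<in> F p \<Longrightarrow> \<not> sat (canonical f \<nu>) (f p) (\<lambda>n. \<nu> (Var n)) \<phi>"
proof (induction "depth \<phi>" arbitrary: \<phi> p rule: less_induct)
  case less
  let ?M = "canonical f \<nu>"
  let ?\<sigma> = "\<lambda>n. \<nu> (Var n)"
  have p: "p \<in> N" using F_in less.prems by blast
  have inv: "inv f (f q) = q" for q using f by simp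
  have val: "tm_val ?M (f p) ?\<sigma> = \<nu>" by (rule ext) simp
  have inner: "inner ?M (f p) = \<nu> ` S p" by (simp add: canonical_def inv)
  have pred: "pred_int ?M (f p) P = {map \<nu> ts | ts. Neg P ts \<in> F p}" for P
    by (simp add: canonical_def inv)
  have acc: "(f p, x) \<in> acc ?M \<longleftrightarrow> (\<exists>u. x = f u \<and> (p, u) \<in> R)" for x
    using inj_eq[OF f] by (auto simp: canonical_def)
  have "const_int ?M x a = const_int ?M y a" for x y a by (simp add: canonical_def)
  from sat_inst[OF this] have inst: "sat ?M (f p) ?\<sigma> (inst t \<psi>) \<longleftrightarrow> sat ?M (f p) (case_nat (\<nu> t) ?\<sigma>) \<psi>" for t \<psi>
    by simp
  show ?case
  proof (cases \<phi>)
    case (Pos P ts)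
    have "Neg P us \<notin> F p" if "map \<nu> ts = map \<nu> us" for us
    proof
      assume us: "Neg P us \<in> F p"
      \<comment> \<open>Equal values amount to disequalities at the root, which \<open>rig\<close>
        copies to \<open>p\<close>; they then rewrite \<open>us\<close> into
        \<open>ts\<close>.\<close>
      have "list_all2 (\<lambda>t s. Neq t s \<in> F p) us ts"
        unfolding list_all2_conv_all_nth
      proof (intro conjI allI impI)
        show "length us = length ts" using that by (metis length_map)
        fix i assume i: "i < length us"
        then have "us ! i \<in> T" "ts ! i \<in> T"
          using ref_lit[OF us] ref_lit[OF less.prems] Pos \<open>length us = length ts\<close> by (auto simp: T_def)
        moreover have "\<nu> (us ! i) = \<nu> (ts ! i)"
          using that i \<open>length us = length ts\<close> by (metis nth_map)
        ultimately show "Neq (us ! i) (ts ! i) \<in> F p" using \<nu> rig p by blast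
      qed
      then have "Neg P ts \<in> F p" using Neg_replace_all[of p us ts P "[]"] us by simp
      then show False using consistent[OF _ less.prems] Pos by simp
    qed
    then show ?thesis using Pos by (auto simp: pred val)
  next
    case (Neg P ts)
    then show ?thesis using less.prems by (auto simp: pred val)
  next
    case (Eq t s)
    have "t \<in> T" "s \<in> T" using ref_lit[OF less.prems] Eq by (auto simp: T_def)
    moreover have "Neq t s \<notin> F p" using consistent[OF _ less.prems] Eq by simp
    ultimately show ?thesis using Eq \<nu> rig p by auto
  next
    case (Neq t s)
    have "t \<in> T" "s \<in> T" using ref_lit[OF less.prems] Neq by (auto simp: T_def)
    then show ?thesis using Neq \<nu> rig root less.prems by auto
  next
    case (Or \<phi>\<^sub>1 \<phi>\<^sub>2)
    then show ?thesis using less disj[of \<phi>\<^sub>1 \<phi>\<^sub>2 p] by auto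
  next
    case (And \<phi>\<^sub>1 \<phi>\<^sub>2)
    have "\<phi>\<^sub>1 \<in> F p \<or> \<phi>\<^sub>2 \<in> F p" using less.prems And by (simp add: conj)
    then show ?thesis using less.hyps[of \<phi>\<^sub>1] less.hyps[of \<phi>\<^sub>2] And by auto
  next
    case (Ex \<psi>)
    have "\<not> sat ?M (f p) (case_nat (\<nu> t) ?\<sigma>) \<psi>" if "t \<in> S p" for t
    proof -
      have "inst t \<psi> \<in> F p" using less.prems that Ex by (simp add: ex)
      moreover have "depth (inst t \<psi>) < depth \<phi>" using Ex by (simp add: inst_def depth_subst)
      ultimately show ?thesis using less.hyps inst by blast
    qed
    then show ?thesis using Ex by (auto simp: inner)
  next
    case (All \<psi>)
    obtain y where "Var y \<in> S p" "inst (Var y) \<psi> \<in> F p"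
      using less.prems All all by blast
    moreover have "depth (inst (Var y) \<psi>) < depth \<phi>" using All by (simp add: inst_def depth_subst)
    ultimately have "\<not> sat ?M (f p) (case_nat (\<nu> (Var y)) ?\<sigma>) \<psi>" "\<nu> (Var y) \<in> inner ?M (f p)"
      using less.hyps inst inner by blast+
    then show ?thesis using All by auto
  next
    case (Dia \<psi>)
    have "\<psi> \<in> F u" if "(p, u) \<in> R" for u
      using less.prems that Dia dia by (auto simp: R_def)
    then show ?thesis using less.hyps[of \<psi>] Dia by (auto simp: acc)
  next
    case (Box \<psi>)
    obtain i where "p @ [i] \<in> N" "\<psi> \<in> F (p @ [i])"
      using less.prems Box box by blast
    then show ?thesis using less.hyps[of \<psi>] Box R_child[OF p] acc by auto
  qed
qed

lemma not_valid:
  assumes "infinite (UNIV :: 'w set)" "infinite (UNIV :: 'u set)"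
    and "names G \<subseteq> N" "\<And>p t. tm_in G p t \<Longrightarrow> t \<in> S p" "\<And>p \<chi>. fm_in G p \<chi> \<Longrightarrow> \<chi> \<in> F p"
  shows "\<not> valid TYPE('w) TYPE('u) ar C G"
proof
  assume valid: "valid TYPE('w) TYPE('u) ar C G"
  obtain h :: "nat \<Rightarrow> 'w" where "inj h"
    using infinite_countable_subset[OF assms(1)] by blast
  then have f: "inj (h \<circ> to_nat :: name \<Rightarrow> 'w)" (is "inj ?f") by (simp add: inj_compose)
  obtain \<nu> :: "'c tm \<Rightarrow> 'u" where
    \<nu>: "\<And>t s. t \<in> T \<Longrightarrow> s \<in> T \<Longrightarrow> \<nu> t = \<nu> s \<longleftrightarrow> Neq t s \<in> F []" "range \<nu> = \<nu> ` T"
    using ex_valuation[OF assms(2)] by blast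
  let ?M = "canonical ?f \<nu>"
  \<comment> \<open>An interpretation must send all names to worlds, so names outside the tree go to
    the root.\<close>
  define \<iota> where "\<iota> p = ?f (if p \<in> N then p else [])" for p
  have "range (\<lambda>n. \<nu> (Var n)) \<subseteq> outer ?M" using \<nu>(2) by (auto simp: canonical_def)
  moreover have "range \<iota> \<subseteq> worlds ?M" using root by (auto simp: canonical_def \<iota>_def)
  ultimately have holds: "nseq_holds ?M (\<lambda>n. \<nu> (Var n)) \<iota> G"
    using valid is_model_canonical[OF f \<nu>(2)] in_class_canonical[OF f] unfolding valid_def by blast
  have \<iota>: "\<iota> p = ?f p" if "p \<in> names G" for p using that assms(3) by (auto simp: \<iota>_def)
  have "(\<iota> u, \<iota> v) \<in> acc ?M" if "is_child G u v" for u v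
  proof -
    have "(u, v) \<in> R" using that assms(3) R_child by (auto simp: is_child_def)
    moreover have "\<iota> u = ?f u" "\<iota> v = ?f v" using that \<iota> by (auto simp: is_child_def)
    ultimately show ?thesis by (force simp: canonical_def)
  qed
  moreover have "\<nu> t \<in> inner ?M (\<iota> u)" if "u \<in> names G" "t \<in># sig_at G u" for u t
    using assms(4)[of u t] that inv_f_f[OF f] by (auto simp: tm_in_def \<iota> canonical_def)
  ultimately obtain v \<phi> where "v \<in> names G" "\<phi> \<in># fms_at G v" "sat ?M (?f v) (\<lambda>n. \<nu> (Var n)) \<phi>"
    using holds \<iota> by (auto simp: nseq_holds_def)
  then show False
    using canonical_falsifies[OF f \<nu>(1)] assms(5) by (auto simp: fm_in_def)
qed

end

section \<open>The limit of a fair chain\<close>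

text \<open>Each condition has finitely many premises, and each premise holds from some stage on. So
  they hold together at some stage, where the goal is wanted, and the next stage achieves
  it.\<close>

lemma limit_hintikka:
  assumes st: "\<And>n. state C ar (K n) (\<Phi> n)"
    and ext: "\<And>n. extends (K n) (\<Phi> n) (K (Suc n)) (\<Phi> (Suc n))"
    and fair: "\<And>n g. wanted C (K n) (\<Phi> n) g \<Longrightarrow> achieved (K (Suc n)) (\<Phi> (Suc n)) g"
  shows "hintikka C ar (\<Union>n. names (K n)) (\<lambda>p. {t. \<exists>n. tm_in (K n) p t}) (\<lambda>p. \<Union>n. \<Phi> n p)"
proof -
  define N where "N = (\<Union>n. names (K n))"
  define S where "S p = {t. \<exists>n. tm_in (K n) p t}" for p
  define F where "F p = (\<Union>n. \<Phi> n p)" for p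
  have mono: "extends (K m) (\<Phi> m) (K n) (\<Phi> n)" if "m \<le> n" for m n
    using that by (induction rule: dec_induct) (auto intro: extends_refl extends_trans ext)
  have evF: "\<forall>\<^sub>F n in sequentially. \<chi> \<in> \<Phi> n p" if "\<chi> \<in> F p" for \<chi> p
    using that mono unfolding F_def eventually_sequentially extends_def by blast
  have evS: "\<forall>\<^sub>F n in sequentially. tm_in (K n) p t" if "t \<in> S p" for t p
    using that mono unfolding S_def eventually_sequentially extends_def by blast
  have evN: "\<forall>\<^sub>F n in sequentially. p \<in> names (K n)" if "p \<in> N" for p
    using that mono unfolding N_def eventually_sequentially extends_def by blast
  have evP: "\<forall>\<^sub>F n in sequentially. propagates (K n) L w u" if "s \<in> L" "path_on N s w u" for s L w u
  proof -
    have "names (K n) \<subseteq> names (K (Suc n))" for n using ext by (simp add: extends_def)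
    from path_on_Union[OF this that(2)[unfolded N_def]] show ?thesis
      using that(1) by (auto simp: path_on_names propagates_def elim: eventually_mono)
  qed
  have fulfilled: "\<exists>n. achieved (K n) (\<Phi> n) g" if "\<forall>\<^sub>F n in sequentially. wanted C (K n) (\<Phi> n) g" for g
    using fair eventually_happens'[OF sequentially_bot that] by blast
  have fm: "\<chi> \<in> F p" if "\<forall>\<^sub>F n in sequentially. wanted C (K n) (\<Phi> n) (AddFm p \<chi>)" for p \<chi>
    using fulfilled[OF that] by (auto simp: F_def)
  have tm: "t \<in> S p" if "\<forall>\<^sub>F n in sequentially. wanted C (K n) (\<Phi> n) (AddTm p t)" for p t
    using fulfilled[OF that] by (auto simp: S_def)
  have red: "\<exists>n. reduced (K n) (\<Phi> n) p \<chi>" if "\<chi> \<in> F p" "reducible \<chi>" for p \<chi>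
  proof -
    have "\<forall>\<^sub>F n in sequentially. wanted C (K n) (\<Phi> n) (Reduce p \<chi>)"
      using evF[OF that(1)] by (rule eventually_mono) (rule wanted.reduce[OF _ that(2)])
    then show ?thesis using fulfilled by fastforce
  qed
  have "hintikka C ar N S F"
  proof
    show "[] \<in> N" by (simp add: N_def)
    show "p \<in> N \<and> wf_fm ar \<chi>" if "\<chi> \<in> F p" for p \<chi>
      using that st by (auto simp: F_def N_def state_def)
    show "countable (F [])"
    proof -
      have "countable (\<Phi> n [])" for n using st by (simp add: state_def countable_finite)
      then show ?thesis unfolding F_def by blast
    qed
    show "neg L \<notin> F p" if L: "is_literal L" "L \<in> F p" for L p
    proof
      assume "neg L \<in> F p"
      \<comment> \<open>Literals are never consumed, so a complementary pair in the limit is present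
        in one single sequent, which is then an axiom.\<close>
      then have "\<forall>\<^sub>F n in sequentially. L \<in> \<Phi> n p \<and> neg L \<in> \<Phi> n p"
        using evF L(2) by (simp add: eventually_conj)
      then obtain n where n: "L \<in> \<Phi> n p" "neg L \<in> \<Phi> n p"
        using eventually_happens'[OF sequentially_bot] by blast
      have "\<not> reducible L" "\<not> reducible (neg L)" "L \<noteq> neg L" using L(1) by (cases L; simp)+
      then have "fm_in (K n) p L" "fm_in (K n) p (neg L)" using state_fm_in[OF st] n by auto
      then obtain G where "K n = fill p (fmls {#L, neg L#}) G" "p \<in> names G"
        using \<open>L \<noteq> neg L\<close> by (rule ex_context_fm2)
      then have "provable C (K n)" using L(1) provable.ax by simp
      then show False using st by (simp add: state_def)
    qed
    show "\<phi> \<in> F p \<and> \<psi> \<in> F p" if "Or \<phi> \<psi> \<in> F p" for \<phi> \<psi> p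
      using red[OF that] by (auto simp: F_def)
    show "\<phi> \<in> F p \<or> \<psi> \<in> F p" if "And \<phi> \<psi> \<in> F p" for \<phi> \<psi> p
      using red[OF that] by (auto simp: F_def)
    show "\<exists>y. Var y \<in> S p \<and> inst (Var y) \<phi> \<in> F p" if "All \<phi> \<in> F p" for \<phi> p
      using red[OF that] by (auto simp: F_def S_def)
    show "\<exists>i. p @ [i] \<in> N \<and> \<phi> \<in> F (p @ [i])" if "Box \<phi> \<in> F p" for \<phi> p
      using red[OF that] by (auto simp: F_def N_def)
    show "inst t \<phi> \<in> F p" if "Ex \<phi> \<in> F p" "t \<in> S p" for \<phi> p t
      by (rule fm[OF eventually_mono[OF eventually_conj[OF evF[OF that(1)] evS[OF that(2)]]]])
        (use that in \<open>auto intro: wanted.ex\<close>)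
    show "\<phi> \<in> F u" if "Dia \<phi> \<in> F w" "s \<in> lang (SG C) [Fw]" "path_on N s w u" for \<phi> w s u
      by (rule fm[OF eventually_mono[OF eventually_conj[OF evF[OF that(1)] evP[OF that(2,3)]]]])
        (use that in \<open>auto intro: wanted.dia\<close>)
    show "Neq t t \<in> F []" if "\<chi> \<in> F p" "t \<in> literal_tms \<chi>" for \<chi> p t
      by (rule fm[OF eventually_mono[OF evF[OF that(1)]]]) (rule wanted.ref_lit[OF _ that(2)])
    show "Neq t t \<in> F []" if "t \<in> S p" for p t
      by (rule fm[OF eventually_mono[OF evS[OF that]]]) (rule wanted.ref_sig)
    show "Neq (Var 0) (Var 0) \<in> F []"
      by (intro fm always_eventually allI wanted.ref_var)
    show "Neq s r \<in> F p" if "Neq t s \<in> F p" "Neq t r \<in> F p" for t s r p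
      by (rule fm[OF eventually_mono[OF eventually_conj[OF evF[OF that(1)] evF[OF that(2)]]]])
        (use that in \<open>auto intro: wanted.eucl\<close>)
    show "Neg P (ts[i := s]) \<in> F p" if "Neq (ts ! i) s \<in> F p" "Neg P ts \<in> F p" "i < length ts"
      for P ts i s p
      by (rule fm[OF eventually_mono[OF eventually_conj[OF evF[OF that(1)] evF[OF that(2)]]]])
        (use that in \<open>auto intro: wanted.rep\<close>)
    show "Neq s t \<in> F u" if "Neq s t \<in> F w" "u \<in> N" for s t w u
      by (rule fm[OF eventually_mono[OF eventually_conj[OF evF[OF that(1)] evN[OF that(2)]]]])
        (use that in \<open>auto intro: wanted.rig\<close>)
    show "t \<in> S u" if "CondID \<in> C \<or> CondDD \<in> C" "t \<in> S w" "s \<in> dp_lang C" "path_on N s w u"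
      for t w s u
      by (rule tm[OF eventually_mono[OF eventually_conj[OF evS[OF that(2)] evP[OF that(3,4)]]]])
        (use that in \<open>auto intro: wanted.dp\<close>)
    show "\<exists>i. p @ [i] \<in> N" if "CondD \<in> C" "p \<in> N" for p
    proof -
      have "\<forall>\<^sub>F n in sequentially. wanted C (K n) (\<Phi> n) (AddKid p)"
        using evN[OF that(2)] by (rule eventually_mono) (rule wanted.d[OF that(1)])
      from fulfilled[OF this] show ?thesis by (auto simp: N_def)
    qed
    show "S p \<noteq> {}" if "CondNE \<in> C" "p \<in> N" for p
    proof -
      have "\<forall>\<^sub>F n in sequentially. wanted C (K n) (\<Phi> n) (AddSome p)"
        using evN[OF that(2)] by (rule eventually_mono) (rule wanted.nd[OF that(1)])
      from fulfilled[OF this] show ?thesis by (auto simp: S_def)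
    qed
    show "t \<in> S p" if "CondCD \<in> C" "p \<in> N" "Neq t t \<in> F []" for p t
      by (rule tm[OF eventually_mono[OF eventually_conj[OF evN[OF that(2)] evF[OF that(3)]]]])
        (use that in \<open>auto intro: wanted.cd\<close>)
  qed
  then show ?thesis by (simp add: N_def S_def[abs_def] F_def[abs_def])
qed

theorem mainTheorem2:
  fixes ar :: "'p \<Rightarrow> nat"
    and C :: "cond set"
    and G :: "('p, 'c) nseq"
  assumes "infinite (UNIV :: 'w set)"
    and "infinite (UNIV :: 'u set)"
    and "closed_conds TYPE('w) TYPE('u) C"
    and "wf_nseq ar G"
    and "valid TYPE('w) TYPE('u) ar C G"
  shows "provable C G"
proof (rule ccontr)
  assume unprov: "\<not> provable C G"
  have "finite {\<chi>. fm_in G p \<chi>}" for p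
    by (rule finite_subset[of _ "set_mset (fms_at G p)"]) (auto simp: fm_in_def)
  then have "state C ar G (\<lambda>p. {\<chi>. fm_in G p \<chi>})"
    using unprov assms(4) by (auto simp: state_def wf_nseq_def fm_in_def)
  then obtain K \<Phi> where K: "K 0 = G" "\<Phi> 0 = (\<lambda>p. {\<chi>. fm_in G p \<chi>})"
    and st: "\<And>n. state C ar (K n) (\<Phi> n)"
    and ext: "\<And>n. extends (K n) (\<Phi> n) (K (Suc n)) (\<Phi> (Suc n))"
    and fair: "\<And>n g. wanted C (K n) (\<Phi> n) g \<Longrightarrow> achieved (K (Suc n)) (\<Phi> (Suc n)) g"
    by (rule ex_fair_chain) blast
  interpret hintikka C ar "\<Union>n. names (K n)" "\<lambda>p. {t. \<exists>n. tm_in (K n) p t}" "\<lambda>p. \<Union>n. \<Phi> n p"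
    using st ext fair by (rule limit_hintikka)
  have "\<not> valid TYPE('w) TYPE('u) ar C G"
  proof (rule not_valid[OF assms(1,2)])
    show "names G \<subseteq> (\<Union>n. names (K n))" using K(1) by blast
    show "t \<in> {t. \<exists>n. tm_in (K n) p t}" if "tm_in G p t" for p t using that K(1) by blast
    show "\<chi> \<in> (\<Union>n. \<Phi> n p)" if "fm_in G p \<chi>" for p \<chi>
      using that K(2) by (intro UN_I[of 0]) auto
  qed
  then show False using assms(5) by blast
qed

end
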